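(* Let $A_1,\ldots,A_m \in \mathbb{R}^{n \times n}$ be symmetric matrices with $\sum_{i=1}^{m} |A_i| \preceq I_n$, and let $\varepsilon \in (0,1)$ be such that $m = \frac{n}{\varepsilon^2} \ge 100$. Define \[ K := \Big\{ x \in \mathbb{R}^m \;:\; \Big\| \sum_{i=1}^m x_i A_i \Big\|_{\mathrm{op}} \leq \varepsilon \Big\}. \] Then for every $0<\alpha<1$, \[ \gamma_m\Big(\tfrac{50}{\alpha} K + \alpha \sqrt{m}\, B_2^m\Big) \geq \tfrac{1}{2}, \] equivalently $\Pr_{y \sim N(0, I_m)} \big[d\big(y, \tfrac{50}{\alpha} K\big) \le \alpha \sqrt{m}\big] \ge \tfrac{1}{2}$.
   Context: For a symmetric matrix $A=\sum_i \lambda_i v_iv_i^\top$ (eigendecomposition), $|A| := \sum_i |\lambda_i| v_iv_i^\top$. $\|\cdot\|_{\mathrm{op}}$ is the largest singular value. $A \preceq B$ means $B-A$ is positive semidefinite. $B_2^m$ is the closed Euclidean unit ball in $\mathbb{R}^m$; $A+B$ denotes the Minkowski sum. $\gamma_m(S) := \Pr_{y\sim N(0,I_m)}[y\in S]$ is the standard Gaussian measure, and $d(y,S) := \min_{x\in S}\|x-y\|_2$. *)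

theory Defs
  imports "HOL-Probability.Probability"
begin

definition outer_product :: "real^'n \<Rightarrow> real^'n^'n" where
  "outer_product v = (columnvector v :: real^1^'n) ** (rowvector v :: real^'n^1)"

definition eigendecomposition :: "real^'n^'n \<Rightarrow> ('n \<Rightarrow> real) \<Rightarrow> ('n \<Rightarrow> real^'n) \<Rightarrow> bool" where
  "eigendecomposition A l v \<longleftrightarrow>
     (\<forall>i j. v i \<bullet> v j = (if i = j then 1 else 0)) \<and>
     A = (\<Sum>i\<in>UNIV. l i *\<^sub>R outer_product (v i))"

text \<open>Meaningful for symmetric \<open>A\<close> only; existence of an eigendecomposition and independence of its
  choice are proved below (\<open>matrix_abs_eq\<close>, \<open>eigendecomposition_exists\<close>).\<close>

definition matrix_abs :: "real^'n^'n \<Rightarrow> real^'n^'n" where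
  "matrix_abs A = (THE B. \<exists>l v. eigendecomposition A l v \<and>
     B = (\<Sum>i\<in>UNIV. \<bar>l i\<bar> *\<^sub>R outer_product (v i)))"

definition singular_value :: "real^'n^'n \<Rightarrow> real \<Rightarrow> bool" where
  "singular_value A s \<longleftrightarrow> s \<ge> 0 \<and> (\<exists>v. v \<noteq> 0 \<and> (transpose A ** A) *v v = s\<^sup>2 *\<^sub>R v)"

text \<open>The set under \<open>Max\<close> is finite and nonempty: see \<open>op_norm_eq_onorm\<close>.\<close>

definition op_norm :: "real^'n^'n \<Rightarrow> real" where
  "op_norm A = Max {s. singular_value A s}"

definition psd_matrix :: "real^'n^'n \<Rightarrow> bool" where
  "psd_matrix A \<longleftrightarrow> transpose A = A \<and> (\<forall>x. 0 \<le> x \<bullet> (A *v x))"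

definition loewner_le :: "real^'n^'n \<Rightarrow> real^'n^'n \<Rightarrow> bool" (infix "\<preceq>\<^sub>L" 50) where
  "A \<preceq>\<^sub>L B \<longleftrightarrow> psd_matrix (B - A)"

definition std_gaussian :: "(real^'m) measure" where
  "std_gaussian = density lborel (\<lambda>y. ennreal (\<Prod>i\<in>UNIV. std_normal_density (y $ i)))"


lemma outer_product_mult: "outer_product v *v x = (v \<bullet> x) *\<^sub>R v"
  by (simp add: outer_product_def vec_eq_iff matrix_vector_mult_def matrix_matrix_mult_def
      columnvector_def rowvector_def inner_vec_def sum_distrib_left sum_distrib_right algebra_simps)

lemma sum_matrix_mult: "(\<Sum>i\<in>I. f i) *v x = (\<Sum>i\<in>I. f i *v (x :: real^'n))"
  by (induction I rule: infinite_finite_induct) (auto simp: matrix_vector_mult_add_rdistrib)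

lemma spectral_sum_mult:
  "(\<Sum>i\<in>I. l i *\<^sub>R outer_product (v i)) *v x = (\<Sum>i\<in>I. (l i * (v i \<bullet> x)) *\<^sub>R v i)"
  by (simp add: sum_matrix_mult scaleR_matrix_vector_assoc[symmetric] outer_product_mult)

lemma inner_symmetric_matrix:
  fixes A :: "real^'n^'n"
  assumes "transpose A = A"
  shows "x \<bullet> (A *v y) = (A *v x) \<bullet> y"
  by (metis assms dot_lmul_matrix vector_transpose_matrix)

lemma quadratic_max_eigenvector:
  fixes A :: "real^'n^'n"
  assumes sym: "transpose A = A" and S: "subspace S" and inv: "\<And>x. x \<in> S \<Longrightarrow> A *v x \<in> S"
    and v: "v \<in> S" "norm v = 1"
    and max: "\<And>x. x \<in> S \<Longrightarrow> norm x = 1 \<Longrightarrow> x \<bullet> (A *v x) \<le> v \<bullet> (A *v v)"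
  shows "A *v v = (v \<bullet> (A *v v)) *\<^sub>R v"
proof -
  define M where "M = v \<bullet> (A *v v)"
  have le: "x \<bullet> (A *v x) \<le> M * (x \<bullet> x)" if "x \<in> S" for x
  proof (cases "x = 0")
    case False
    have "(x /\<^sub>R norm x) \<bullet> (A *v (x /\<^sub>R norm x)) \<le> M"
      unfolding M_def by (rule max) (use False that S in \<open>auto simp: subspace_scale\<close>)
    hence "x \<bullet> (A *v x) / (norm x)\<^sup>2 \<le> M"
      by (simp add: matrix_vector_mult_scaleR power2_eq_square field_simps)
    thus ?thesis using False by (simp add: field_simps power2_norm_eq_inner)
  qed simp
  define u where "u = A *v v - M *\<^sub>R v"
  have vv: "v \<bullet> v = 1" using v by (simp add: norm_eq_1)
  have uS: "u \<in> S" unfolding u_def by (intro subspace_diff S subspace_scale inv v)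
  have uv: "u \<bullet> v = 0" by (simp add: u_def inner_diff_left inner_diff_right vv M_def inner_commute)
  have uu: "u \<bullet> (A *v v) = u \<bullet> u"
    using uv by (simp add: u_def inner_diff_right[of _ "A *v v"])
  have sy: "v \<bullet> (A *v u) = u \<bullet> u"
    using inner_symmetric_matrix[OF sym, of v u] uu by (simp add: inner_commute)
  define d where "d = M * (u \<bullet> u) - u \<bullet> (A *v u)"
  have key: "2 * t * (u \<bullet> u) \<le> t\<^sup>2 * d" for t
  proof -
    have "v + t *\<^sub>R u \<in> S" by (intro subspace_add S subspace_scale uS v)
    from le[OF this] show ?thesis
      using uv vv uu sy
      by (simp add: d_def M_def matrix_vector_right_distrib matrix_vector_mult_scaleR
          inner_add_left inner_add_right inner_commute[of v u] algebra_simps power2_eq_square)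
  qed
  have "d \<ge> 0" unfolding d_def using le[OF uS] by simp
  have "u \<bullet> u = 0"
  proof (rule ccontr)
    assume "u \<bullet> u \<noteq> 0"
    hence pos: "u \<bullet> u > 0" by simp
    define t where "t = (u \<bullet> u) / (d + 1)"
    have t: "t > 0" using pos \<open>d \<ge> 0\<close> by (simp add: t_def)
    have "t * (2 * (u \<bullet> u)) \<le> t * (t * d)"
      using key[of t] by (simp add: power2_eq_square algebra_simps)
    hence "2 * (u \<bullet> u) \<le> t * d" using t by simp
    also have "\<dots> \<le> t * (d + 1)" using t by simp
    also have "\<dots> = u \<bullet> u" using \<open>d \<ge> 0\<close> by (simp add: t_def)
    finally show False using pos by simp
  qed
  thus ?thesis by (simp add: u_def M_def)
qed

lemma quadratic_max_exists:
  fixes A :: "real^'n^'n"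
  assumes S: "subspace S" and ne: "S \<noteq> {0}"
  obtains v where "v \<in> S" "norm v = 1"
    "\<And>x. x \<in> S \<Longrightarrow> norm x = 1 \<Longrightarrow> x \<bullet> (A *v x) \<le> v \<bullet> (A *v v)"
proof -
  have "compact (sphere 0 1 \<inter> S)"
    by (intro compact_Int_closed compact_sphere closed_subspace S)
  moreover obtain x where "x \<in> S" "x \<noteq> 0" using ne S subspace_0 by blast
  hence "x /\<^sub>R norm x \<in> sphere 0 1 \<inter> S" using S by (auto simp: subspace_scale)
  hence "sphere 0 1 \<inter> S \<noteq> {}" by blast
  moreover have "continuous_on (sphere 0 1 \<inter> S) (\<lambda>x. x \<bullet> (A *v x))"
    by (intro continuous_intros)
  ultimately obtain v where "v \<in> sphere 0 1 \<inter> S"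
      "\<forall>x\<in>sphere 0 1 \<inter> S. x \<bullet> (A *v x) \<le> v \<bullet> (A *v v)"
    using continuous_attains_sup[of "sphere 0 1 \<inter> S" "\<lambda>x. x \<bullet> (A *v x)"] by blast
  thus ?thesis using that by auto
qed

lemma orthonormal_eigenbasis:
  fixes A :: "real^'n^'n"
  assumes sym: "transpose A = A"
  shows "subspace S \<Longrightarrow> (\<And>x. x \<in> S \<Longrightarrow> A *v x \<in> S) \<Longrightarrow>
    \<exists>B. B \<subseteq> S \<and> pairwise orthogonal B \<and> (\<forall>b\<in>B. norm b = 1 \<and> (\<exists>c. A *v b = c *\<^sub>R b)) \<and> S \<subseteq> span B"
proof (induction "dim S" arbitrary: S rule: less_induct)
  case less
  show ?case
  proof (cases "S = {0}")
    case True
    thus ?thesis by (intro exI[of _ "{}"]) auto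
  next
    case False
    obtain v where v: "v \<in> S" "norm v = 1"
      "\<And>x. x \<in> S \<Longrightarrow> norm x = 1 \<Longrightarrow> x \<bullet> (A *v x) \<le> v \<bullet> (A *v v)"
      using quadratic_max_exists[OF less.prems(1) False, of A] by metis
    define c where "c = v \<bullet> (A *v v)"
    have Av: "A *v v = c *\<^sub>R v"
      unfolding c_def by (rule quadratic_max_eigenvector[OF sym less.prems v])
    have vv: "v \<bullet> v = 1" using v by (simp add: norm_eq_1)
    define T where "T = S \<inter> {x. v \<bullet> x = 0}"
    have T: "subspace T" unfolding T_def
      using less.prems(1) by (auto simp: subspace_def inner_add_right)
    have TA: "A *v x \<in> T" if "x \<in> T" for x
      using that less.prems(2) inner_symmetric_matrix[OF sym, of v x] by (auto simp: T_def Av)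
    have "v \<notin> T" using vv by (simp add: T_def)
    moreover have "T \<subseteq> S" by (simp add: T_def)
    ultimately have "T \<subset> S" using v(1) by blast
    hence "dim T < dim S"
      using dim_psubset[of T S] T less.prems(1) by (simp add: span_eq_iff[THEN iffD2])
    from less.hyps[OF this T TA] obtain B where B: "B \<subseteq> T" "pairwise orthogonal B"
      "\<forall>b\<in>B. norm b = 1 \<and> (\<exists>c. A *v b = c *\<^sub>R b)" "T \<subseteq> span B" by blast
    have "S \<subseteq> span (insert v B)"
    proof
      fix x assume x: "x \<in> S"
      have "x - (v \<bullet> x) *\<^sub>R v \<in> T" using x v(1) less.prems(1)
        by (auto simp: T_def inner_diff_right vv intro!: subspace_diff subspace_scale)
      hence "x - (v \<bullet> x) *\<^sub>R v \<in> span B" using B by blast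
      thus "x \<in> span (insert v B)" by (auto simp: span_insert)
    qed
    moreover have "pairwise orthogonal (insert v B)"
      using B(1,2) by (auto simp: pairwise_insert T_def orthogonal_def inner_commute)
    ultimately show ?thesis
      using B v Av by (intro exI[of _ "insert v B"]) (auto simp: T_def)
  qed
qed

lemma orthonormal_family_expand:
  fixes v :: "'n \<Rightarrow> real^'n"
  assumes on: "\<And>i j. v i \<bullet> v j = (if i = j then 1 else 0)"
  shows "x = (\<Sum>i\<in>UNIV. (v i \<bullet> x) *\<^sub>R v i)"
proof -
  have inj: "inj v"
  proof (rule injI)
    fix i j assume "v i = v j"
    thus "i = j" using on[of i j] on[of i i] by (auto split: if_splits)
  qed
  have "independent (range v)"
    by (rule pairwise_orthogonal_independent)
      (use on in \<open>auto simp: pairwise_def orthogonal_def, metis inner_zero_left zero_neq_one\<close>)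
  moreover have "card (range v) = CARD('n)" by (rule card_image[OF inj])
  ultimately have sp: "span (range v) = UNIV"
    using card_eq_dim[of "range v" UNIV] by auto
  define y where "y = x - (\<Sum>i\<in>UNIV. (v i \<bullet> x) *\<^sub>R v i)"
  have "orthogonal y (v j)" for j
  proof -
    have "(\<Sum>i\<in>UNIV. (v i \<bullet> x) * (v i \<bullet> v j)) = (\<Sum>i\<in>UNIV. if i = j then v i \<bullet> x else 0)"
      by (rule sum.cong) (auto simp: on)
    thus ?thesis
      by (simp add: y_def orthogonal_def inner_diff_left inner_sum_left) (simp add: inner_commute)
  qed
  hence "orthogonal y y" using orthogonal_to_span[of y "range v" y] sp by auto
  thus ?thesis by (simp add: y_def orthogonal_def)
qed

lemma spectral_sum_eigen:
  fixes v :: "'n \<Rightarrow> real^'n"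
  assumes "\<And>i j. v i \<bullet> v j = (if i = j then 1 else 0)"
  shows "(\<Sum>i\<in>UNIV. l i *\<^sub>R outer_product (v i)) *v v j = l j *\<^sub>R (v j :: real^'n)"
proof -
  have "(\<Sum>i\<in>UNIV. (l i * (v i \<bullet> v j)) *\<^sub>R v i) = (\<Sum>i\<in>UNIV. if i = j then l i *\<^sub>R v i else 0)"
    by (rule sum.cong) (auto simp: assms)
  thus ?thesis by (simp add: spectral_sum_mult)
qed

lemma matrix_eq_on_orthonormal:
  fixes A B :: "real^'n^'n" and v :: "'n \<Rightarrow> real^'n"
  assumes on: "\<And>i j. v i \<bullet> v j = (if i = j then 1 else 0)" and eq: "\<And>i. A *v v i = B *v v i"
  shows "A = B"
proof -
  have "A *v x = B *v x" for x
    by (subst (1 2) orthonormal_family_expand[OF on, of x])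
      (simp add: linear_sum[OF matrix_vector_mul_linear] matrix_vector_mult_scaleR eq)
  thus ?thesis by (simp add: matrix_eq)
qed

lemma eigendecomposition_exists:
  fixes A :: "real^'n^'n"
  assumes sym: "transpose A = A"
  shows "\<exists>l v. eigendecomposition A l v"
proof -
  obtain B where B: "pairwise orthogonal B"
      "\<forall>b\<in>B. norm b = 1 \<and> (\<exists>c. A *v b = c *\<^sub>R b)" "span B = (UNIV :: (real^'n) set)"
    using orthonormal_eigenbasis[OF sym, of UNIV] by auto
  have ind: "independent B" by (rule pairwise_orthogonal_independent) (use B in auto)
  hence fin: "finite B" by (rule finiteI_independent)
  have "card B = CARD('n)"
    using dim_eq_card_independent[OF ind] dim_span[of B] B(3) by simp
  then obtain v where v: "bij_betw v (UNIV :: 'n set) B"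
    using finite_same_card_bij[of "UNIV :: 'n set" B] fin by auto
  have vB: "v i \<in> B" for i using v by (auto simp: bij_betw_def)
  have on: "v i \<bullet> v j = (if i = j then 1 else 0)" for i j
  proof (cases "i = j")
    case False
    hence "v i \<noteq> v j" using v by (auto simp: bij_betw_def inj_def)
    thus ?thesis using B(1) vB False by (auto simp: pairwise_def orthogonal_def)
  qed (use B(2) vB in \<open>auto simp: norm_eq_1\<close>)
  have "\<forall>i. \<exists>c. A *v v i = c *\<^sub>R v i" using B(2) vB by blast
  then obtain l where l: "\<And>i. A *v v i = l i *\<^sub>R v i" by metis
  have "A = (\<Sum>i\<in>UNIV. l i *\<^sub>R outer_product (v i))"
    by (rule matrix_eq_on_orthonormal[OF on]) (simp add: l spectral_sum_eigen[OF on])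
  thus ?thesis using on unfolding eigendecomposition_def by blast
qed

lemma eigendecomposition_coeff:
  assumes ed: "eigendecomposition A l v" and w: "A *v w = \<mu> *\<^sub>R w" and nz: "v i \<bullet> w \<noteq> 0"
  shows "l i = \<mu>"
proof -
  have on: "\<And>i j. v i \<bullet> v j = (if i = j then 1 else 0)"
    using ed by (simp add: eigendecomposition_def)
  have "A *v w = (\<Sum>j\<in>UNIV. (l j * (v j \<bullet> w)) *\<^sub>R v j)"
    using ed spectral_sum_mult[of l v UNIV w] by (simp add: eigendecomposition_def)
  hence "v i \<bullet> (A *v w) = (\<Sum>j\<in>UNIV. l j * (v j \<bullet> w) * (v i \<bullet> v j))"
    by (simp add: inner_sum_right)
  also have "\<dots> = (\<Sum>j\<in>UNIV. if j = i then l j * (v j \<bullet> w) else 0)"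
    by (rule sum.cong) (auto simp: on)
  finally have "v i \<bullet> (A *v w) = l i * (v i \<bullet> w)" by simp
  hence "l i * (v i \<bullet> w) = \<mu> * (v i \<bullet> w)" using w by auto
  thus ?thesis using nz by simp
qed

lemma matrix_abs_eq:
  fixes A :: "real^'n^'n"
  assumes ed: "eigendecomposition A l v"
  shows "matrix_abs A = (\<Sum>i\<in>UNIV. \<bar>l i\<bar> *\<^sub>R outer_product (v i))"
  unfolding matrix_abs_def
proof (rule the_equality)
  fix B assume "\<exists>l v. eigendecomposition A l v \<and> B = (\<Sum>i\<in>UNIV. \<bar>l i\<bar> *\<^sub>R outer_product (v i))"
  then obtain k w where ed': "eigendecomposition A k w"
    and B: "B = (\<Sum>i\<in>UNIV. \<bar>k i\<bar> *\<^sub>R outer_product (w i))" by blast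
  have on: "\<And>i j. v i \<bullet> v j = (if i = j then 1 else 0)"
    and on': "\<And>i j. w i \<bullet> w j = (if i = j then 1 else 0)"
    using ed ed' by (simp_all add: eigendecomposition_def)
  show "B = (\<Sum>i\<in>UNIV. \<bar>l i\<bar> *\<^sub>R outer_product (v i))"
  proof (rule matrix_eq_on_orthonormal[OF on'])
    fix j
    have Aw: "A *v w j = k j *\<^sub>R w j"
      using ed' spectral_sum_eigen[OF on', of k j] by (simp add: eigendecomposition_def)
    have "(\<Sum>i\<in>UNIV. \<bar>l i\<bar> *\<^sub>R outer_product (v i)) *v w j
        = (\<Sum>i\<in>UNIV. \<bar>k j\<bar> *\<^sub>R ((v i \<bullet> w j) *\<^sub>R v i))"
      unfolding spectral_sum_mult using eigendecomposition_coeff[OF ed Aw]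
      by (intro sum.cong) auto
    also have "\<dots> = \<bar>k j\<bar> *\<^sub>R w j"
      by (simp only: scaleR_sum_right[symmetric] orthonormal_family_expand[OF on, of "w j", symmetric])
    finally show "B *v w j = (\<Sum>i\<in>UNIV. \<bar>l i\<bar> *\<^sub>R outer_product (v i)) *v w j"
      by (simp add: B spectral_sum_eigen[OF on'])
  qed
qed (use ed in blast)

lemma op_norm_eq_onorm:
  fixes A :: "real^'n^'n"
  shows "op_norm A = onorm ((*v) A)"
proof -
  let ?G = "transpose A ** A"
  have sym: "transpose ?G = ?G" by (simp add: matrix_transpose_mul transpose_transpose)
  have quad: "x \<bullet> (?G *v x) = (norm (A *v x))\<^sup>2" for x
    by (metis dot_lmul_matrix matrix_vector_mul_assoc power2_norm_eq_inner vector_transpose_matrix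
        transpose_transpose)
  obtain l v where ed: "eigendecomposition ?G l v" using eigendecomposition_exists[OF sym] by blast
  have on: "\<And>i j. v i \<bullet> v j = (if i = j then 1 else 0)"
    using ed by (simp add: eigendecomposition_def)
  have "{s. singular_value A s} \<subseteq> (\<lambda>i. sqrt (l i)) ` UNIV"
  proof
    fix s assume "s \<in> {s. singular_value A s}"
    then obtain w where s: "s \<ge> 0" "w \<noteq> 0" "?G *v w = s\<^sup>2 *\<^sub>R w" by (auto simp: singular_value_def)
    have "\<exists>i. v i \<bullet> w \<noteq> 0"
    proof (rule ccontr)
      assume "\<not> ?thesis"
      hence "w = 0" using orthonormal_family_expand[OF on, of w] by simp
      with s show False by simp
    qed
    then obtain i where "v i \<bullet> w \<noteq> 0" by blast
    hence "l i = s\<^sup>2" using eigendecomposition_coeff[OF ed s(3)] by blast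
    thus "s \<in> (\<lambda>i. sqrt (l i)) ` UNIV" using s(1) by (auto intro!: image_eqI[of _ _ i])
  qed
  hence fin: "finite {s. singular_value A s}" by (rule finite_subset) simp
  have bl: "bounded_linear ((*v) A)" by (rule matrix_vector_mul_bounded_linear)
  have "(UNIV :: (real^'n) set) \<noteq> {0}"
    using UNIV_not_singleton by blast
  then obtain u where u: "norm u = 1"
      "\<And>x. norm x = 1 \<Longrightarrow> x \<bullet> (?G *v x) \<le> u \<bullet> (?G *v u)"
    using quadratic_max_exists[of UNIV ?G] by auto
  have Gu: "?G *v u = (norm (A *v u))\<^sup>2 *\<^sub>R u"
    using quadratic_max_eigenvector[OF sym subspace_UNIV, of u] u by (simp add: quad)
  have ule: "norm (A *v x) \<le> norm (A *v u) * norm x" for x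
  proof (cases "x = 0")
    case False
    have "(norm (A *v (x /\<^sub>R norm x)))\<^sup>2 \<le> (norm (A *v u))\<^sup>2"
      using u(2)[of "x /\<^sub>R norm x"] False by (simp add: quad)
    hence "norm (A *v (x /\<^sub>R norm x)) \<le> norm (A *v u)"
      by (rule power2_le_imp_le) simp
    thus ?thesis using False by (simp add: matrix_vector_mult_scaleR field_simps)
  qed simp
  have eq: "onorm ((*v) A) = norm (A *v u)"
    using onorm_le[of "(*v) A", OF ule] onorm[OF bl, of u] u(1) by simp
  have "singular_value A (norm (A *v u))"
    unfolding singular_value_def using Gu u(1) by (metis norm_ge_zero norm_zero zero_neq_one)
  moreover have "s \<le> norm (A *v u)" if sv: "singular_value A s" for s
  proof -
    obtain w where s: "s \<ge> 0" "w \<noteq> 0" "?G *v w = s\<^sup>2 *\<^sub>R w" using sv by (auto simp: singular_value_def)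
    have "(norm (A *v w))\<^sup>2 = (s * norm w)\<^sup>2"
      using quad[of w] by (simp add: s(3) power_mult_distrib power2_norm_eq_inner)
    hence "norm (A *v w) = s * norm w" using s(1) by (simp add: power2_eq_iff_nonneg)
    with ule[of w] show ?thesis using s(2) by simp
  qed
  ultimately show ?thesis
    unfolding op_norm_def eq using fin by (intro Max_eqI) auto
qed

lemma prob_space_std_gaussian: "prob_space (std_gaussian :: (real^'m) measure)"
proof
  have inj: "inj (\<lambda>i :: 'm. axis i (1::real))" by (auto simp: inj_def axis_eq_axis)
  have Basis: "(Basis :: (real^'m) set) = range (\<lambda>i. axis i 1)" by (auto simp: Basis_vec_def)
  have prod: "(\<Prod>i\<in>UNIV. std_normal_density (y $ i)) = (\<Prod>b\<in>Basis. std_normal_density (y \<bullet> b))"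
    for y :: "real^'m"
    unfolding Basis by (subst prod.reindex[OF inj]) (simp add: inner_axis)
  have "emeasure (std_gaussian :: (real^'m) measure) (space std_gaussian)
      = (\<integral>\<^sup>+y. (\<Prod>b\<in>Basis. ennreal (std_normal_density (y \<bullet> b))) \<partial>(lborel :: (real^'m) measure))"
    by (simp add: std_gaussian_def emeasure_density prod prod_ennreal)
  also have "\<dots> = (\<Prod>b\<in>(Basis :: (real^'m) set). \<integral>\<^sup>+x. ennreal (std_normal_density x) \<partial>lborel)"
    by (rule nn_integral_lborel_prod) auto
  also have "(\<integral>\<^sup>+x. ennreal (std_normal_density x) \<partial>lborel) = 1"
    using prob_space.emeasure_space_1[OF prob_space_normal_density[of 1 0]]
    by (simp add: emeasure_density)
  finally show "emeasure (std_gaussian :: (real^'m) measure) (space std_gaussian) = 1" by simp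
qed

end

theory Submission
  imports Defs
begin

text \<open>
  Put \<open>S x = \<Sum> x\<^sub>i A\<^sub>i\<close> and \<open>R = 50 \<epsilon> / \<alpha>\<close>. Instead of the metric projection of \<open>y\<close> onto
  \<open>(50/\<alpha>) K = {x. \<parallel>S x\<parallel> \<le> R}\<close> take the proximal point \<open>x\<close> of the logarithmic barrier
  \<open>F x = - log det (R - S x) - log det (R + S x)\<close>, that is, the solution of
  \<open>y = x + \<nabla>F x / R\<^sup>2\<close>. It lies in \<open>(50/\<alpha>) K\<close>, so it suffices to bound \<open>E |y - x|\<^sup>2\<close>. Let
  \<open>U = (R - S x)\<^sup>-\<^sup>1\<close> and \<open>V = (R + S x)\<^sup>-\<^sup>1\<close>.

  Write \<open>|y - x|\<^sup>2 = y \<bullet> (y - x) - x \<bullet> (y - x)\<close>. The second product is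
  \<open>tr (S x (U - V)) / R\<^sup>2 = tr (U + V) / R - 2 n / R\<^sup>2\<close>. Gaussian integration by parts turns
  the expectation of the first one into that of \<open>\<Sum>\<^sub>i \<partial>\<^sub>i (y - x)\<^sub>i\<close>, where with \<open>H\<close> the Hessian of \<open>F\<close>
  \<open>\<partial>\<^sub>i (y - x)\<^sub>i \<le> min 1 (H\<^sub>i\<^sub>i / R\<^sup>2) \<le> sqrt H\<^sub>i\<^sub>i / R \<le> tr ((U + V) |A\<^sub>i|) / R\<close>. Since
  \<open>\<Sum> |A\<^sub>i| \<preceq> I\<close>, these terms sum to at most \<open>tr (U + V) / R\<close>. The possibly large traces cancel,
  so \<open>E |y - x|\<^sup>2 \<le> 2 n / R\<^sup>2 = \<alpha>\<^sup>2 m / 1250\<close>, and Markov's inequality concludes.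
\<close>

section \<open>Traces and positive semidefinite matrices\<close>

lemma bounded_bilinear_matrix_mult:
  "bounded_bilinear ((**) :: real^'n^'m \<Rightarrow> real^'p^'n \<Rightarrow> real^'p^'m)"
  unfolding bilinear_conv_bounded_bilinear[symmetric] bilinear_def
  by (auto intro!: linearI simp: vec_eq_iff matrix_matrix_mult_def sum.distrib sum_distrib_left
      algebra_simps)

interpretation matrix_mult: bounded_bilinear "(**) :: real^'n^'m \<Rightarrow> real^'p^'n \<Rightarrow> real^'p^'m"
  by (rule bounded_bilinear_matrix_mult)

lemma linear_trace: "linear (trace :: real^'n^'n \<Rightarrow> real)"
  by (rule linearI) (simp_all add: trace_def sum.distrib sum_distrib_left)

lemmas trace_sum = linear_sum[OF linear_trace]
  and trace_scaleR = linear_scale[OF linear_trace]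

lemma continuous_on_trace [continuous_intros]:
  "continuous_on X f \<Longrightarrow> continuous_on X (\<lambda>x. trace (f x :: real^'n^'n))"
  unfolding trace_def by (intro continuous_intros)

lemma trace_transpose: "trace (transpose A) = trace A"
  by (simp add: trace_def transpose_def)

lemma transpose_add: "transpose (A + B) = transpose A + transpose B"
  by (simp add: transpose_def vec_eq_iff)

lemma transpose_diff: "transpose (A - B) = transpose A - transpose B"
  by (simp add: transpose_def vec_eq_iff)

lemma transpose_scaleR: "transpose (c *\<^sub>R A) = c *\<^sub>R transpose A"
  by (simp add: transpose_def vec_eq_iff)

lemma transpose_sum: "transpose (\<Sum>i\<in>I. f i) = (\<Sum>i\<in>I. transpose (f i))"
  by (simp add: transpose_def vec_eq_iff)

lemma transpose_outer_product: "transpose (outer_product v) = outer_product v"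
  by (simp add: outer_product_def transpose_def vec_eq_iff matrix_matrix_mult_def
      columnvector_def rowvector_def mult.commute)

lemma trace_mult_outer_product:
  fixes P :: "real^'n^'n"
  shows "trace (P ** outer_product v) = v \<bullet> (P *v v)"
  by (simp add: trace_def outer_product_def matrix_matrix_mult_def columnvector_def rowvector_def
      inner_vec_def matrix_vector_mult_def sum_distrib_left mult.commute mult.left_commute)

lemma trace_mult_spectral_sum:
  fixes P :: "real^'n^'n"
  shows "trace (P ** (\<Sum>k\<in>I. l k *\<^sub>R outer_product (v k))) = (\<Sum>k\<in>I. l k * (v k \<bullet> (P *v v k)))"
  by (simp add: matrix_mult.sum_right trace_sum matrix_mult.scaleR_right trace_scaleR
      trace_mult_outer_product)

lemma psd_eigendecomposition:
  assumes "psd_matrix P"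
  obtains l v where "eigendecomposition P l v" "\<And>k. 0 \<le> l k"
proof -
  obtain l v where ed: "eigendecomposition P l v"
    using assms eigendecomposition_exists unfolding psd_matrix_def by blast
  have on: "\<And>i j. v i \<bullet> v j = (if i = j then 1 else 0)"
    using ed by (simp add: eigendecomposition_def)
  have "P *v v k = l k *\<^sub>R v k" for k
    using ed spectral_sum_eigen[OF on, of l k] by (simp add: eigendecomposition_def)
  hence "v k \<bullet> (P *v v k) = l k" for k by (simp add: on)
  moreover have "0 \<le> v k \<bullet> (P *v v k)" for k using assms by (simp add: psd_matrix_def)
  ultimately show ?thesis using that[OF ed] by metis
qed

text \<open>In an eigenbasis of \<open>Q\<close> the trace is a combination, with nonnegative
  coefficients, of values of the quadratic form of \<open>P\<close>. Traces are compared below by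
  applying this to a difference of matrices.\<close>

lemma trace_psd_mult_nonneg:
  assumes "psd_matrix P" "psd_matrix Q"
  shows "0 \<le> trace (P ** Q)"
proof -
  obtain l v where ed: "eigendecomposition Q l v" "\<And>k. 0 \<le> l k"
    using psd_eigendecomposition[OF assms(2)] by blast
  hence "trace (P ** Q) = (\<Sum>k\<in>UNIV. l k * (v k \<bullet> (P *v v k)))"
    using trace_mult_spectral_sum by (auto simp: eigendecomposition_def)
  also have "\<dots> \<ge> 0"
    using assms(1) ed(2) by (intro sum_nonneg mult_nonneg_nonneg) (auto simp: psd_matrix_def)
  finally show ?thesis .
qed

lemma psd_matrix_congruence:
  assumes "psd_matrix P" "transpose X = X"
  shows "psd_matrix (X ** P ** X)"
  unfolding psd_matrix_def
proof (intro conjI allI)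
  show "transpose (X ** P ** X) = X ** P ** X"
    using assms by (simp add: matrix_transpose_mul psd_matrix_def matrix_mul_assoc)
  fix x
  have "x \<bullet> ((X ** P ** X) *v x) = (X *v x) \<bullet> (P *v (X *v x))"
    by (simp add: matrix_vector_mul_assoc[symmetric] inner_symmetric_matrix[OF assms(2), of x])
  thus "0 \<le> x \<bullet> ((X ** P ** X) *v x)" using assms(1) by (simp add: psd_matrix_def)
qed

text \<open>Scaling the coordinates in an eigenbasis by the roots of the eigenvalues turns the form
  of \<open>P\<close> into a Euclidean inner product.\<close>

lemma psd_cauchy_schwarz:
  fixes P :: "real^'n^'n"
  assumes "psd_matrix P"
  shows "\<bar>u \<bullet> (P *v w)\<bar> \<le> sqrt (u \<bullet> (P *v u)) * sqrt (w \<bullet> (P *v w))"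
proof -
  obtain l v where ed: "eigendecomposition P l v" "\<And>k. 0 \<le> l k"
    using psd_eigendecomposition[OF assms] by blast
  have sq: "(sqrt (l k) * c) * (sqrt (l k) * d) = c * (l k * d)" for k c d
    using real_sqrt_mult_self[of "l k"] ed(2)[of k] by (simp add: algebra_simps)
  have P: "P = (\<Sum>k\<in>UNIV. l k *\<^sub>R outer_product (v k))" using ed(1) by (simp add: eigendecomposition_def)
  define V where "V a = (\<chi> k. sqrt (l k) * (v k \<bullet> a))" for a
  have "a \<bullet> (P *v b) = V a \<bullet> V b" for a b
    unfolding P spectral_sum_mult V_def
    by (simp add: inner_vec_def[of "vec_lambda _"] sq) (simp add: inner_sum_right inner_commute mult_ac)
  thus ?thesis using Cauchy_Schwarz_ineq2[of "V u" "V w"] by (simp add: norm_eq_sqrt_inner)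
qed

text \<open>With both copies of \<open>A\<close> expanded in an eigenbasis the trace is a double
  sum. Cauchy-Schwarz for \<open>P\<close> and \<open>Q\<close>, then the AM-GM inequality, bound
  each summand by a factor in \<open>k\<close> times a factor in \<open>j\<close>, so the bound is a
  square. The eigenvalues survive only as absolute values, whence
  \<open>matrix_abs A\<close>.\<close>

lemma trace_sandwich_le:
  fixes A :: "real^'n^'n"
  assumes sym: "transpose A = A" and P: "psd_matrix P" and Q: "psd_matrix Q"
  shows "trace (A ** P ** A ** Q) \<le> ((trace (P ** matrix_abs A) + trace (Q ** matrix_abs A)) / 2)\<^sup>2"
proof -
  obtain l v where ed: "eigendecomposition A l v" using eigendecomposition_exists[OF sym] by blast
  let ?p = "\<lambda>k. v k \<bullet> (P *v v k)" and ?q = "\<lambda>k. v k \<bullet> (Q *v v k)"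
  have A: "A = (\<Sum>k\<in>UNIV. l k *\<^sub>R outer_product (v k))" using ed by (simp add: eigendecomposition_def)
  have Px: "0 \<le> x \<bullet> (P *v x)" and Qx: "0 \<le> x \<bullet> (Q *v x)" for x
    using P Q by (simp_all add: psd_matrix_def)
  have AA: "(P ** A ** Q) *v x = (\<Sum>j\<in>UNIV. (l j * (v j \<bullet> (Q *v x))) *\<^sub>R (P *v v j))" for x
    by (simp add: matrix_vector_mul_assoc[symmetric])
      (subst A, simp add: spectral_sum_mult linear_sum[OF matrix_vector_mul_linear]
        matrix_vector_mult_scaleR)
  have "trace (A ** P ** A ** Q) = trace ((P ** A ** Q) ** A)"
    by (metis matrix_mul_assoc trace_mul_sym)
  also have "\<dots> = (\<Sum>k\<in>UNIV. l k * (v k \<bullet> ((P ** A ** Q) *v v k)))"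
    by (subst (2) A) (rule trace_mult_spectral_sum)
  also have "\<dots> = (\<Sum>k\<in>UNIV. \<Sum>j\<in>UNIV. l k * (l j * (v j \<bullet> (Q *v v k)) * (v k \<bullet> (P *v v j))))"
    by (simp add: AA inner_sum_right sum_distrib_left)
  also have "\<dots> \<le> (\<Sum>k\<in>UNIV. \<Sum>j\<in>UNIV. (\<bar>l k\<bar> * ((?p k + ?q k) / 2)) * (\<bar>l j\<bar> * ((?p j + ?q j) / 2)))"
  proof (intro sum_mono)
    fix k j
    have "l k * (l j * (v j \<bullet> (Q *v v k)) * (v k \<bullet> (P *v v j)))
        \<le> \<bar>l k\<bar> * (\<bar>l j\<bar> * \<bar>v j \<bullet> (Q *v v k)\<bar> * \<bar>v k \<bullet> (P *v v j)\<bar>)"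
      by (metis abs_ge_self abs_mult)
    also have "\<dots> \<le> \<bar>l k\<bar> * (\<bar>l j\<bar> * (sqrt (?q j) * sqrt (?q k)) * (sqrt (?p k) * sqrt (?p j)))"
      by (intro mult_left_mono mult_mono psd_cauchy_schwarz P Q) (auto simp: Px Qx)
    also have "\<dots> = (\<bar>l k\<bar> * sqrt (?p k * ?q k)) * (\<bar>l j\<bar> * sqrt (?p j * ?q j))"
      by (simp add: real_sqrt_mult)
    also have "\<dots> \<le> (\<bar>l k\<bar> * ((?p k + ?q k) / 2)) * (\<bar>l j\<bar> * ((?p j + ?q j) / 2))"
      by (intro mult_mono mult_left_mono arith_geo_mean_sqrt) (auto simp: Px Qx)
    finally show "l k * (l j * (v j \<bullet> (Q *v v k)) * (v k \<bullet> (P *v v j))) \<le> \<dots>" .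
  qed
  also have "\<dots> = (\<Sum>k\<in>UNIV. \<bar>l k\<bar> * ((?p k + ?q k) / 2))\<^sup>2"
    by (simp add: power2_eq_square sum_product)
  also have "(\<Sum>k\<in>UNIV. \<bar>l k\<bar> * ((?p k + ?q k) / 2))
      = (trace (P ** matrix_abs A) + trace (Q ** matrix_abs A)) / 2"
    by (simp add: matrix_abs_eq[OF ed] trace_mult_spectral_sum sum.distrib[symmetric]
        sum_divide_distrib[symmetric] distrib_left)
  finally show ?thesis .
qed

lemma psd_matrix_abs:
  fixes A :: "real^'n^'n"
  assumes "transpose A = A"
  shows "psd_matrix (matrix_abs A)"
proof -
  obtain l v where ed: "eigendecomposition A l v" using eigendecomposition_exists[OF assms] by blast
  thus ?thesis
    by (simp add: psd_matrix_def matrix_abs_eq[OF ed] transpose_sum transpose_scaleR transpose_outer_product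
        spectral_sum_mult inner_sum_right inner_commute sum_nonneg mult.assoc)
qed

section \<open>Matrix inverses: resolvent identity, continuity, positivity\<close>

lemma invertible_matrix_inv:
  assumes "invertible (B :: real^'n^'n)"
  shows "B ** matrix_inv B = mat 1" "matrix_inv B ** B = mat 1"
  using someI_ex[OF assms[unfolded invertible_def]] by (simp_all add: matrix_inv_def)

lemma matrix_inv_diff:
  fixes B C :: "real^'n^'n"
  assumes "invertible B" "invertible C"
  shows "matrix_inv C - matrix_inv B = matrix_inv C ** (B - C) ** matrix_inv B"
  using invertible_matrix_inv[OF assms(1)] invertible_matrix_inv[OF assms(2)]
  by (simp add: matrix_mult.diff_left matrix_mult.diff_right matrix_mul_assoc[symmetric])

text \<open>By the resolvent identity the error \<open>?e\<close> is at most
  \<open>d y * (norm (?V x) + ?e)\<close> with \<open>d y\<close> tending to 0; once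
  \<open>d y < 1 / 2\<close>, the \<open>?e\<close> on the right is absorbed.\<close>

lemma continuous_on_matrix_inv:
  fixes B :: "'a::topological_space \<Rightarrow> real^'n^'n"
  assumes cont: "continuous_on S B" and inv: "\<And>x. x \<in> S \<Longrightarrow> invertible (B x)"
  shows "continuous_on S (\<lambda>x. matrix_inv (B x))"
  unfolding continuous_on_def
proof
  fix x assume x: "x \<in> S"
  let ?V = "\<lambda>x. matrix_inv (B x)" and ?F = "at x within S"
  obtain K where K: "K > 0" "\<And>X Y. norm ((X :: real^'n^'n) ** (Y :: real^'n^'n)) \<le> norm X * norm Y * K"
    using matrix_mult.pos_bounded by blast
  define d where "d y = norm (B x - B y) * norm (?V x) * K * K" for y
  have "(B \<longlongrightarrow> B x) ?F" using cont x by (simp add: continuous_on_def)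
  hence d0: "(d \<longlongrightarrow> 0) ?F"
    unfolding d_def by (intro tendsto_eq_intros | assumption | simp)+
  have "\<forall>\<^sub>F y in ?F. d y < 1 / 2" using d0 by (rule order_tendstoD) simp
  moreover have "\<forall>\<^sub>F y in ?F. y \<in> S" by (simp add: eventually_at_filter)
  ultimately have "\<forall>\<^sub>F y in ?F. norm (?V y - ?V x) \<le> 2 * d y * norm (?V x)"
  proof eventually_elim
    case (elim y)
    let ?e = "norm (?V y - ?V x)"
    have d_nonneg: "0 \<le> d y" using K(1) by (simp add: d_def)
    have "?e = norm (?V y ** (B x - B y) ** ?V x)"
      using matrix_inv_diff[OF inv[OF x] inv[OF elim(2)]] by simp
    also have "\<dots> \<le> norm (?V y ** (B x - B y)) * norm (?V x) * K" by (rule K(2))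
    also have "\<dots> \<le> (norm (?V y) * norm (B x - B y) * K) * norm (?V x) * K"
      using K(1) K(2)[of "?V y" "B x - B y"] by (intro mult_right_mono) auto
    also have "\<dots> = d y * norm (?V y)" by (simp add: d_def)
    also have "\<dots> \<le> d y * (norm (?V x) + ?e)"
      using d_nonneg norm_triangle_sub[of "?V y" "?V x"] by (intro mult_left_mono) auto
    also have "\<dots> \<le> d y * norm (?V x) + 1 / 2 * ?e"
      using elim(1) mult_right_mono[of "d y" "1/2" ?e] by (simp add: distrib_left)
    finally show ?case by (simp add: mult.assoc)
  qed
  moreover have "((\<lambda>y. 2 * d y * norm (?V x)) \<longlongrightarrow> 0) ?F"
    using d0 by (auto intro!: tendsto_eq_intros)
  ultimately have "((\<lambda>y. ?V y - ?V x) \<longlongrightarrow> 0) ?F"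
    by (rule Lim_null_comparison)
  thus "(?V \<longlongrightarrow> ?V x) ?F" by (simp add: LIM_zero_iff)
qed


lemma psd_matrix_inv:
  fixes B :: "real^'n^'n"
  assumes psd: "psd_matrix B" and inv: "invertible B"
  shows "psd_matrix (matrix_inv B)"
  unfolding psd_matrix_def
proof (intro conjI allI)
  note BU = invertible_matrix_inv[OF inv]
  have sym: "transpose B = B" using psd by (simp add: psd_matrix_def)
  have "transpose (matrix_inv B) ** B = mat 1"
    using arg_cong[OF BU(1), of transpose] by (simp add: matrix_transpose_mul sym transpose_mat)
  hence "transpose (matrix_inv B) ** B ** matrix_inv B = matrix_inv B" by simp
  thus "transpose (matrix_inv B) = matrix_inv B" by (simp add: matrix_mul_assoc[symmetric] BU)
  fix x
  have "B *v (matrix_inv B *v x) = x" by (simp add: matrix_vector_mul_assoc BU)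
  hence "x \<bullet> (matrix_inv B *v x) = (matrix_inv B *v x) \<bullet> (B *v (matrix_inv B *v x))"
    by (simp add: inner_commute)
  thus "0 \<le> x \<bullet> (matrix_inv B *v x)" using psd by (simp add: psd_matrix_def)
qed

lemma psd_matrix_outer_product_complement:
  fixes w :: "real^'n"
  shows "psd_matrix ((w \<bullet> w) *\<^sub>R mat 1 - outer_product w)"
proof -
  have "(w \<bullet> x) * (w \<bullet> x) \<le> (w \<bullet> w) * (x \<bullet> x)" for x
    using Cauchy_Schwarz_ineq[of w x] by (simp add: power2_eq_square)
  thus ?thesis
    by (simp add: psd_matrix_def transpose_diff transpose_scaleR transpose_mat transpose_outer_product
        matrix_vector_mult_diff_rdistrib scaleR_matrix_vector_assoc[symmetric] outer_product_mult
        inner_diff_right inner_commute)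
qed

text \<open>Pair \<open>P\<close> with the complement of the outer product of \<open>w\<close>,
  which is positive semidefinite by Cauchy-Schwarz.\<close>

lemma psd_quadratic_le_trace:
  fixes P :: "real^'n^'n"
  assumes "psd_matrix P"
  shows "w \<bullet> (P *v w) \<le> trace P * (w \<bullet> w)"
proof -
  have "0 \<le> trace (P ** ((w \<bullet> w) *\<^sub>R mat 1 - outer_product w))"
    by (rule trace_psd_mult_nonneg[OF assms psd_matrix_outer_product_complement])
  thus ?thesis
    by (simp add: matrix_mult.diff_right trace_sub matrix_mult.scaleR_right trace_scaleR
        trace_mult_outer_product mult.commute)
qed

text \<open>In effect the least eigenvalue of \<open>B\<close> is at least
  \<open>1 / \<tau>\<close>; the undivided form is the one that passes to limits. It follows from
  Cauchy-Schwarz for \<open>matrix_inv B\<close> at \<open>w\<close> and \<open>B *v w\<close>, the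
  form of \<open>matrix_inv B\<close> being controlled by its trace.\<close>

lemma quadratic_ge_inverse_trace:
  fixes B :: "real^'n^'n"
  assumes psd: "psd_matrix B" and inv: "invertible B" and le: "trace (matrix_inv B) \<le> \<tau>"
  shows "w \<bullet> w \<le> \<tau> * (w \<bullet> (B *v w))"
proof (cases "w = 0")
  case False
  let ?U = "matrix_inv B"
  have U: "psd_matrix ?U" by (rule psd_matrix_inv[OF psd inv])
  have UB: "?U *v (B *v w) = w" by (simp add: matrix_vector_mul_assoc invertible_matrix_inv[OF inv])
  have nonneg: "0 \<le> w \<bullet> (B *v w)" "0 \<le> w \<bullet> (?U *v w)" using psd U by (simp_all add: psd_matrix_def)
  have "w \<bullet> w \<le> sqrt (w \<bullet> (?U *v w)) * sqrt (w \<bullet> (B *v w))"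
    using psd_cauchy_schwarz[OF U, of w "B *v w"] by (simp add: UB inner_commute)
  hence "(w \<bullet> w)\<^sup>2 \<le> (w \<bullet> (?U *v w)) * (w \<bullet> (B *v w))"
    using nonneg power_mono[of "w \<bullet> w" _ 2] by (fastforce simp: power_mult_distrib)
  also have "\<dots> \<le> (\<tau> * (w \<bullet> w)) * (w \<bullet> (B *v w))"
    using psd_quadratic_le_trace[OF U, of w] mult_right_mono[OF le, of "w \<bullet> w"] nonneg
    by (intro mult_right_mono) auto
  finally have "(w \<bullet> w) * (w \<bullet> w) \<le> (w \<bullet> w) * (\<tau> * (w \<bullet> (B *v w)))"
    by (simp add: power2_eq_square mult_ac)
  thus ?thesis using False by simp
qed simp

section \<open>Operator norms and quadratic forms\<close>

lemma norm_orthonormal_sum: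
  fixes v :: "'n \<Rightarrow> real^'n"
  assumes on: "\<And>i j. v i \<bullet> v j = (if i = j then 1 else 0)"
  shows "(norm (\<Sum>k\<in>UNIV. a k *\<^sub>R v k))\<^sup>2 = (\<Sum>k\<in>UNIV. (a k)\<^sup>2)"
  unfolding power2_norm_eq_inner
  by (simp add: inner_sum_left inner_sum_right on power2_eq_square if_distrib cong: if_cong)

text \<open>Testing the hypothesis on eigenvectors bounds the eigenvalues by \<open>c\<close>;
  Parseval's identity in the eigenbasis then bounds the norm.\<close>

lemma onorm_symmetric_le:
  fixes A :: "real^'n^'n"
  assumes sym: "transpose A = A" and c: "0 \<le> c" and le: "\<And>x. \<bar>x \<bullet> (A *v x)\<bar> \<le> c * (x \<bullet> x)"
  shows "onorm ((*v) A) \<le> c"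
proof (rule onorm_le)
  fix x
  obtain l v where ed: "eigendecomposition A l v" using eigendecomposition_exists[OF sym] by blast
  have on: "\<And>i j. v i \<bullet> v j = (if i = j then 1 else 0)"
    using ed by (simp add: eigendecomposition_def)
  have A: "A = (\<Sum>k\<in>UNIV. l k *\<^sub>R outer_product (v k))" using ed by (simp add: eigendecomposition_def)
  have "\<bar>l k\<bar> \<le> \<bar>c\<bar>" for k
    using le[of "v k"] c unfolding A spectral_sum_eigen[OF on] by (simp add: on)
  hence l: "(l k)\<^sup>2 \<le> c\<^sup>2" for k by (simp add: abs_le_square_iff)
  have "(norm (A *v x))\<^sup>2 = (\<Sum>k\<in>UNIV. (l k)\<^sup>2 * (v k \<bullet> x)\<^sup>2)"
    unfolding A spectral_sum_mult norm_orthonormal_sum[OF on] by (simp add: power_mult_distrib)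
  also have "\<dots> \<le> (\<Sum>k\<in>UNIV. c\<^sup>2 * (v k \<bullet> x)\<^sup>2)" by (intro sum_mono mult_right_mono l) simp
  also have "\<dots> = c\<^sup>2 * (norm (\<Sum>k\<in>UNIV. (v k \<bullet> x) *\<^sub>R v k))\<^sup>2"
    unfolding norm_orthonormal_sum[OF on] by (simp add: sum_distrib_left)
  also have "\<dots> = (c * norm x)\<^sup>2"
    by (simp add: orthonormal_family_expand[OF on, of x, symmetric] power_mult_distrib)
  finally show "norm (A *v x) \<le> c * norm x" using c by (auto intro: power2_le_imp_le)
qed

lemma abs_inner_le_onorm:
  fixes A :: "real^'n^'n"
  shows "\<bar>x \<bullet> (A *v x)\<bar> \<le> onorm ((*v) A) * (x \<bullet> x)"
proof -
  have "\<bar>x \<bullet> (A *v x)\<bar> \<le> norm x * norm (A *v x)" by (rule Cauchy_Schwarz_ineq2)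
  also have "\<dots> \<le> norm x * (onorm ((*v) A) * norm x)"
    by (intro mult_left_mono onorm matrix_vector_mul_bounded_linear) auto
  finally show ?thesis by (simp add: power2_norm_eq_inner[symmetric] power2_eq_square mult_ac)
qed

lemma continuous_on_onorm_matrix:
  "continuous_on UNIV (\<lambda>A :: real^'n^'n. onorm ((*v) A))"
proof -
  have "bounded_bilinear ((*v) :: real^'n^'n \<Rightarrow> real^'n \<Rightarrow> real^'n)"
    unfolding bilinear_conv_bounded_bilinear[symmetric] bilinear_def
    by (auto intro!: linearI simp: matrix_vector_mult_add_rdistrib matrix_vector_right_distrib
        scaleR_matrix_vector_assoc[symmetric] matrix_vector_mult_scaleR)
  then obtain K where K: "K > 0" "\<And>A x. norm ((A :: real^'n^'n) *v x) \<le> norm A * norm x * K"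
    using bounded_bilinear.pos_bounded by blast
  have le: "onorm ((*v) A) \<le> K * norm A" for A :: "real^'n^'n"
    by (rule onorm_le) (use K(2)[of A] in \<open>simp add: mult_ac\<close>)
  have tri: "onorm ((*v) A) - onorm ((*v) B) \<le> K * norm (A - B)" for A B :: "real^'n^'n"
  proof -
    have "onorm (\<lambda>x. B *v x + (A - B) *v x) \<le> onorm ((*v) B) + onorm ((*v) (A - B))"
      by (intro onorm_triangle matrix_vector_mul_bounded_linear)
    moreover have "(\<lambda>x. B *v x + (A - B) *v x) = (*v) A"
      by (simp add: matrix_vector_mult_diff_rdistrib fun_eq_iff)
    ultimately show ?thesis using le[of "A - B"] by simp
  qed
  have "K-lipschitz_on UNIV (\<lambda>A :: real^'n^'n. onorm ((*v) A))"
  proof (rule lipschitz_onI)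
    fix A B :: "real^'n^'n"
    show "dist (onorm ((*v) A)) (onorm ((*v) B)) \<le> K * dist A B"
      using tri[of A B] tri[of B A] by (simp add: dist_norm norm_minus_commute abs_le_iff)
  qed (use K in simp)
  thus ?thesis by (rule lipschitz_on_continuous_on)
qed

lemma nonneg_quadratic_discriminant:
  fixes a b c :: real
  assumes nonneg: "\<And>s. 0 \<le> a + 2 * b * s + c * s\<^sup>2" and c: "0 \<le> c"
  shows "b\<^sup>2 \<le> a * c"
proof (cases "c = 0")
  case True
  have "b = 0"
  proof (rule ccontr)
    assume "b \<noteq> 0"
    \<comment> \<open>This argument gives the affine function the value -1.\<close>
    thus False using nonneg[of "- (a + 1) / (2 * b)"] True by simp
  qed
  thus ?thesis using True by simp
next
  case False
  hence "c > 0" using c by simp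
  \<comment> \<open>The point \<open>- b / c\<close> minimises the quadratic.\<close>
  have eq: "a + 2 * b * (- b / c) + c * (- b / c)\<^sup>2 = a - b\<^sup>2 / c"
    using \<open>c > 0\<close> by (simp add: power2_eq_square field_simps)
  have "0 \<le> a - b\<^sup>2 / c" using nonneg[of "- b / c"] unfolding eq .
  thus ?thesis using \<open>c > 0\<close> by (simp add: pos_divide_le_eq)
qed

section \<open>Integration by parts for the standard Gaussian measure\<close>

lemma sets_std_gaussian [measurable_cong, simp]: "sets std_gaussian = sets borel"
  by (simp add: std_gaussian_def)

lemma space_std_gaussian [simp]: "space std_gaussian = UNIV"
  by (simp add: std_gaussian_def)

text \<open>Completing the square shows that an exponential tilt of the standard density is a
  multiple of a shifted normal density. The absolute value is handled by adding the tilts for both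
  signs.\<close>

lemma integrable_exp_abs_std_normal:
  "integrable lborel (\<lambda>x. exp (c * \<bar>x\<bar>) * std_normal_density x)"
proof (rule Bochner_Integration.integrable_bound)
  have *: "exp (a * x) * std_normal_density x = exp (a\<^sup>2 / 2) * normal_density a 1 x" for a x :: real
    by (simp add: normal_density_def exp_add[symmetric] field_simps power2_eq_square)
  show "integrable lborel (\<lambda>x. exp (c * x) * std_normal_density x + exp (- c * x) * std_normal_density x)"
    unfolding * by (intro Bochner_Integration.integrable_add integrable_mult_right) auto
  show "AE x in lborel. norm (exp (c * \<bar>x\<bar>) * std_normal_density x)
      \<le> norm (exp (c * x) * std_normal_density x + exp (- c * x) * std_normal_density x)"
  proof (rule AE_I2)
    fix x :: real
    have "0 \<le> exp (c * x) * std_normal_density x" "0 \<le> exp (- c * x) * std_normal_density x" by simp_all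
    thus "norm (exp (c * \<bar>x\<bar>) * std_normal_density x)
      \<le> norm (exp (c * x) * std_normal_density x + exp (- c * x) * std_normal_density x)"
      unfolding real_norm_def by (cases "x \<ge> 0") (simp_all add: abs_mult)
  qed
qed simp

text \<open>Integrand and density factor over the coordinates. These exponentials dominate all
  powers of the norm and the difference quotients in the integration by parts.\<close>

lemma integrable_std_gaussian_exp:
  "integrable std_gaussian (\<lambda>y :: real^'m. exp (c * (\<Sum>i\<in>UNIV. \<bar>y $ i\<bar>)))"
proof (rule integrableI_nonneg)
  have inj: "inj (\<lambda>i :: 'm. axis i (1::real))" by (auto simp: inj_def axis_eq_axis)
  have Basis: "(Basis :: (real^'m) set) = range (\<lambda>i. axis i 1)" by (auto simp: Basis_vec_def)
  let ?f = "\<lambda>x::real. ennreal (exp (c * \<bar>x\<bar>) * std_normal_density x)"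
  have prod: "ennreal (\<Prod>i\<in>UNIV. std_normal_density (y $ i)) * ennreal (exp (c * (\<Sum>i\<in>UNIV. \<bar>y $ i\<bar>)))
      = (\<Prod>b\<in>Basis. ?f (y \<bullet> b))" for y :: "real^'m"
    unfolding Basis
    by (subst prod.reindex[OF inj])
      (simp add: inner_axis prod_ennreal sum_distrib_left exp_sum ennreal_mult[symmetric] prod_nonneg
        prod.distrib[symmetric] mult.commute)
  have "(\<integral>\<^sup>+y. ennreal (exp (c * (\<Sum>i\<in>UNIV. \<bar>y $ i\<bar>))) \<partial>(std_gaussian :: (real^'m) measure))
      = (\<integral>\<^sup>+y. (\<Prod>b\<in>Basis. ?f (y \<bullet> b)) \<partial>(lborel :: (real^'m) measure))"
    by (simp add: std_gaussian_def nn_integral_density prod)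
  also have "\<dots> = (\<Prod>b\<in>(Basis :: (real^'m) set). \<integral>\<^sup>+x. ?f x \<partial>lborel)"
    by (rule nn_integral_lborel_prod) auto
  also have "\<dots> < \<infinity>"
    using integrable_exp_abs_std_normal[of c]
    by (subst nn_integral_eq_integral) (auto intro!: AE_I2 simp: power_less_top_ennreal)
  finally show "(\<integral>\<^sup>+y. ennreal (exp (c * (\<Sum>i\<in>UNIV. \<bar>y $ i\<bar>))) \<partial>(std_gaussian :: (real^'m) measure)) < \<infinity>" .
qed auto

lemma norm_le_exp_sum_abs: "norm (y :: real^'m) \<le> exp (\<Sum>i\<in>UNIV. \<bar>y $ i\<bar>)"
  using norm_le_l1_cart[of y] exp_ge_add_one_self[of "\<Sum>i\<in>UNIV. \<bar>y $ i\<bar>"] by linarith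

lemma integrable_std_gaussian_norm_power:
  "integrable std_gaussian (\<lambda>y :: real^'m. norm y ^ k)"
proof (rule Bochner_Integration.integrable_bound[OF integrable_std_gaussian_exp[of "real k"]])
  show "AE y :: real^'m in std_gaussian. norm (norm y ^ k) \<le> norm (exp (real k * (\<Sum>i\<in>UNIV. \<bar>y $ i\<bar>)))"
    using power_mono[OF norm_le_exp_sum_abs norm_ge_zero] by (intro AE_I2) (simp add: exp_of_nat_mult)
qed simp

text \<open>The Cameron-Martin formula for a shift along one axis: Lebesgue measure is translation
  invariant, and only the \<open>i\<close>-th factor of the density changes.\<close>

lemma integral_std_gaussian_shift:
  fixes f :: "real^'m \<Rightarrow> real"
  assumes [measurable]: "f \<in> borel_measurable borel"
  shows "(\<integral>y. f (y + t *\<^sub>R axis i 1) \<partial>std_gaussian) = (\<integral>y. f y * exp (t * y $ i - t\<^sup>2 / 2) \<partial>std_gaussian)"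
proof -
  define \<rho> where "\<rho> y = (\<Prod>j\<in>UNIV. std_normal_density (y $ j))" for y :: "real^'m"
  have \<rho>_nonneg: "0 \<le> \<rho> y" for y unfolding \<rho>_def by (intro prod_nonneg) auto
  have [measurable]: "\<rho> \<in> borel_measurable borel" unfolding \<rho>_def by measurable
  have one: "std_normal_density (s - t) = std_normal_density s * exp (t * s - t\<^sup>2 / 2)" for s
    by (simp add: std_normal_density_def exp_add[symmetric] power2_eq_square algebra_simps
        diff_divide_distrib add_divide_distrib)
  have \<rho>: "\<rho> (y - t *\<^sub>R axis i 1) = \<rho> y * exp (t * y $ i - t\<^sup>2 / 2)" for y
  proof -
    have "(\<Prod>j\<in>UNIV - {i}. std_normal_density ((y - t *\<^sub>R axis i 1) $ j))
        = (\<Prod>j\<in>UNIV - {i}. std_normal_density (y $ j))"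
      by (rule prod.cong) (auto simp: axis_def)
    thus ?thesis
      unfolding \<rho>_def by (subst (1 2) prod.remove[of _ i]) (auto simp: one axis_def)
  qed
  have "(\<integral>y. f (y + t *\<^sub>R axis i 1) \<partial>std_gaussian) = (\<integral>y. \<rho> y * f (y + t *\<^sub>R axis i 1) \<partial>lborel)"
    unfolding std_gaussian_def \<rho>_def[symmetric] by (subst integral_density) (auto simp: \<rho>_nonneg)
  also have "\<dots> = (\<integral>y. \<rho> ((t *\<^sub>R axis i 1 + y) - t *\<^sub>R axis i 1) * f (t *\<^sub>R axis i 1 + y) \<partial>lborel)"
    by (simp add: add.commute)
  also have "\<dots> = (\<integral>z. \<rho> (z - t *\<^sub>R axis i 1) * f z \<partial>(distr lborel borel ((+) (t *\<^sub>R axis i 1))))"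
    by (subst integral_distr) auto
  also have "\<dots> = (\<integral>z. \<rho> z * (f z * exp (t * z $ i - t\<^sup>2 / 2)) \<partial>lborel)"
    by (simp add: lborel_distr_plus \<rho> mult_ac)
  also have "\<dots> = (\<integral>y. f y * exp (t * y $ i - t\<^sup>2 / 2) \<partial>std_gaussian)"
    unfolding std_gaussian_def \<rho>_def[symmetric] by (subst integral_density) (auto simp: \<rho>_nonneg)
  finally show ?thesis .
qed

text \<open>A bound uniform in \<open>t\<close>, as dominated convergence requires. The inequality
  \<open>\<bar>u\<bar> \<le> t * (\<bar>z\<bar> + 1)\<close> supplies the factor \<open>t\<close>
  that cancels the denominator.\<close>

lemma exp_quotient_bound:
  fixes z t :: real
  assumes "0 < t" "t \<le> 1"
  shows "\<bar>(exp (t * z - t\<^sup>2 / 2) - 1) / t\<bar> \<le> exp 2 * exp (2 * \<bar>z\<bar>)"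
proof -
  define u where "u = t * z - t\<^sup>2 / 2"
  have "t\<^sup>2 / 2 \<le> t * 1" using assms by (simp add: power2_eq_square mult_left_le)
  moreover have "\<bar>u\<bar> \<le> t * \<bar>z\<bar> + t\<^sup>2 / 2"
    unfolding u_def using assms abs_triangle_ineq4[of "t * z" "t\<^sup>2 / 2"] by (simp add: abs_mult)
  ultimately have u: "\<bar>u\<bar> \<le> t * (\<bar>z\<bar> + 1)" by (simp add: distrib_left)
  have "\<bar>exp u - 1\<bar> \<le> \<bar>u\<bar> * exp \<bar>u\<bar>"
  proof (cases "u \<ge> 0")
    case True
    have "1 - exp (- u) \<le> u" using exp_ge_add_one_self[of "-u"] by simp
    hence "(1 - exp (- u)) * exp u \<le> u * exp u" by (intro mult_right_mono) auto
    thus ?thesis using True by (simp add: left_diff_distrib mult_exp_exp)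
  next
    case False
    have "exp u \<le> 1" using False by simp
    hence "\<bar>exp u - 1\<bar> \<le> \<bar>u\<bar> * 1" using exp_ge_add_one_self[of u] by linarith
    also have "\<dots> \<le> \<bar>u\<bar> * exp \<bar>u\<bar>" by (intro mult_left_mono) auto
    finally show ?thesis .
  qed
  also have "\<dots> \<le> t * (\<bar>z\<bar> + 1) * exp (\<bar>z\<bar> + 1)"
  proof (intro mult_mono u)
    have "t * (\<bar>z\<bar> + 1) \<le> 1 * (\<bar>z\<bar> + 1)" using assms by (intro mult_right_mono) auto
    thus "exp \<bar>u\<bar> \<le> exp (\<bar>z\<bar> + 1)" using u by simp
  qed (use assms in auto)
  also have "\<dots> \<le> t * exp (\<bar>z\<bar> + 1) * exp (\<bar>z\<bar> + 1)"
    using assms exp_ge_add_one_self[of "\<bar>z\<bar> + 1"] by (intro mult_right_mono mult_left_mono) auto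
  also have "\<dots> = t * (exp 2 * exp (2 * \<bar>z\<bar>))" by (simp add: mult_exp_exp)
  finally show ?thesis using assms by (simp add: u_def abs_divide field_simps)
qed

text \<open>Gaussian integration by parts for a function that need not be differentiable: the derivative
  is replaced by a bound on difference quotients, and the shift by \<open>t\<close> is moved to the density.\<close>

lemma std_gaussian_stein_le:
  fixes g q :: "real^'m \<Rightarrow> real"
  assumes contg: "continuous_on UNIV g" and contq: "continuous_on UNIV q"
    and g: "\<And>y. \<bar>g y\<bar> \<le> norm y" and q: "\<And>y. 0 \<le> q y"
    and quotient: "\<And>y t. 0 < t \<Longrightarrow>
      g (y + t *\<^sub>R axis i 1) - g y \<le> t * min 1 ((q y + q (y + t *\<^sub>R axis i 1)) / 2)"
  shows "(\<integral>y. g y * y $ i \<partial>std_gaussian) \<le> (\<integral>y. min 1 (q y) \<partial>std_gaussian)"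
proof -
  interpret prob_space "std_gaussian :: (real^'m) measure" by (rule prob_space_std_gaussian)
  have [measurable]: "g \<in> borel_measurable borel" "q \<in> borel_measurable borel"
    using contg contq by (simp_all add: borel_measurable_continuous_onI)
  define t where "t k = 1 / real (Suc k)" for k
  have t: "0 < t k" "t k \<le> 1" for k by (simp_all add: t_def)
  have t0: "t \<longlonglongrightarrow> 0" unfolding t_def by (rule LIMSEQ_Suc[OF lim_1_over_n])
  let ?e = "axis i 1 :: real^'m"
  let ?G = "\<lambda>k y. g y * ((exp (t k * y $ i - (t k)\<^sup>2 / 2) - 1) / t k)"
  let ?Q = "\<lambda>k y. min 1 ((q y + q (y + t k *\<^sub>R ?e)) / 2)"
  \<comment> \<open>One multiple of the sum in the exponent bounds \<open>g\<close> through the norm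
    and two bound the quotient, hence the 3.\<close>
  define w where "w y = exp 2 * exp (3 * (\<Sum>i\<in>UNIV. \<bar>y $ i\<bar>))" for y :: "real^'m"
  have int_w: "integrable std_gaussian w"
    unfolding w_def by (intro integrable_mult_right integrable_std_gaussian_exp)
  have Gw: "norm (?G k y) \<le> w y" for k y
  proof -
    let ?s = "\<Sum>i\<in>UNIV. \<bar>y $ i\<bar>"
    have "\<bar>y $ i\<bar> \<le> ?s" by (rule member_le_sum) auto
    hence "exp 2 * exp (2 * \<bar>y $ i\<bar>) \<le> exp 2 * exp (2 * ?s)" by simp
    hence "norm (?G k y) \<le> exp ?s * (exp 2 * exp (2 * ?s))"
      unfolding real_norm_def abs_mult
      by (intro mult_mono order_trans[OF g] norm_le_exp_sum_abs
          order_trans[OF exp_quotient_bound[OF t]]) auto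
    also have "\<dots> = w y" by (simp add: w_def mult_exp_exp)
    finally show ?thesis .
  qed
  have lim_G: "(\<lambda>k. \<integral>y. ?G k y \<partial>std_gaussian) \<longlonglongrightarrow> (\<integral>y. g y * y $ i \<partial>std_gaussian)"
  proof (rule integral_dominated_convergence[OF _ _ int_w])
    show "AE y in std_gaussian. (\<lambda>k. ?G k y) \<longlonglongrightarrow> g y * y $ i"
    proof (intro AE_I2 tendsto_mult tendsto_const)
      fix y :: "real^'m"
      have "((\<lambda>s. exp (s * y $ i - s\<^sup>2 / 2)) has_real_derivative y $ i) (at 0)"
        by (auto intro!: derivative_eq_intros)
      hence "((\<lambda>s. (exp (s * y $ i - s\<^sup>2 / 2) - 1) / s) \<longlongrightarrow> y $ i) (at 0)"
        by (simp add: has_field_derivative_iff)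
      moreover have "filterlim t (at 0) sequentially"
        using t0 t(1) by (auto simp: filterlim_at intro!: always_eventually) (metis less_irrefl)
      ultimately show "(\<lambda>k. (exp (t k * y $ i - (t k)\<^sup>2 / 2) - 1) / t k) \<longlonglongrightarrow> y $ i"
        by (rule filterlim_compose)
    qed
  qed (use Gw in \<open>auto intro!: AE_I2\<close>)
  have lim_Q: "(\<lambda>k. \<integral>y. ?Q k y \<partial>std_gaussian) \<longlonglongrightarrow> (\<integral>y. min 1 (q y) \<partial>std_gaussian)"
  proof (rule integral_dominated_convergence[where w = "\<lambda>_. 1"])
    show "AE y in std_gaussian. (\<lambda>k. ?Q k y) \<longlonglongrightarrow> min 1 (q y)"
    proof (rule AE_I2)
      fix y :: "real^'m"
      have "(\<lambda>k. y + t k *\<^sub>R ?e) \<longlonglongrightarrow> y + 0 *\<^sub>R ?e" by (intro tendsto_intros t0)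
      moreover have "isCont q y" using contq by (simp add: continuous_on_eq_continuous_at)
      ultimately have "(\<lambda>k. q (y + t k *\<^sub>R ?e)) \<longlonglongrightarrow> q y"
        using isCont_tendsto_compose by fastforce
      hence "(\<lambda>k. ?Q k y) \<longlonglongrightarrow> min 1 ((q y + q y) / 2)" by (intro tendsto_intros) simp_all
      thus "(\<lambda>k. ?Q k y) \<longlonglongrightarrow> min 1 (q y)" by simp
    qed
  qed (use q in \<open>auto intro!: AE_I2 simp: abs_le_iff add_nonneg_nonneg min_def\<close>)
  have "(\<integral>y. ?G k y \<partial>std_gaussian) \<le> (\<integral>y. ?Q k y \<partial>std_gaussian)" for k
  proof -
    have int_g: "integrable std_gaussian g"
      by (rule Bochner_Integration.integrable_bound[OF integrable_std_gaussian_norm_power[of 1]])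
        (use g in auto)
    have int_g': "integrable std_gaussian (\<lambda>y. g (y + t k *\<^sub>R ?e))"
    proof (rule Bochner_Integration.integrable_bound)
      show "integrable std_gaussian (\<lambda>y :: real^'m. norm y ^ 1 + 1)"
        by (intro Bochner_Integration.integrable_add integrable_std_gaussian_norm_power) simp
      have "\<bar>g (y + t k *\<^sub>R ?e)\<bar> \<le> norm y + 1" for y
        using g[of "y + t k *\<^sub>R ?e"] norm_triangle_ineq[of y "t k *\<^sub>R ?e"] t[of k] by simp
      thus "AE y in std_gaussian. norm (g (y + t k *\<^sub>R ?e)) \<le> norm (norm y ^ 1 + 1)"
        by (intro AE_I2) simp
    qed simp
    have int_G: "integrable std_gaussian (?G k)"
      by (rule Bochner_Integration.integrable_bound[OF int_w]) (use Gw in \<open>auto intro!: AE_I2 simp: w_def\<close>)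
    \<comment> \<open>The shift formula turns the mean increment of \<open>g\<close> into
      \<open>t k\<close> times the integral of \<open>?G k\<close>, to which the hypothesis
      \<open>quotient\<close> then applies.\<close>
    have "(\<integral>y. g (y + t k *\<^sub>R ?e) \<partial>std_gaussian)
        = (\<integral>y. t k * ?G k y + g y \<partial>std_gaussian)"
      unfolding integral_std_gaussian_shift[OF \<open>g \<in> borel_measurable borel\<close>]
      using t(1)[of k] by (intro Bochner_Integration.integral_cong) (auto simp: field_simps)
    also have "\<dots> = t k * (\<integral>y. ?G k y \<partial>std_gaussian) + (\<integral>y. g y \<partial>std_gaussian)"
      by (simp only: Bochner_Integration.integral_add[OF integrable_mult_right[OF int_G] int_g]
          integral_mult_right_zero)
    finally have "t k * (\<integral>y. ?G k y \<partial>std_gaussian) = (\<integral>y. g (y + t k *\<^sub>R ?e) - g y \<partial>std_gaussian)"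
      using int_g int_g' by simp
    also have "\<dots> \<le> (\<integral>y. t k * ?Q k y \<partial>std_gaussian)"
    proof (rule integral_mono)
      show "integrable std_gaussian (\<lambda>y. t k * ?Q k y)"
        by (intro integrable_mult_right integrable_const_bound[where B = 1])
          (use q in \<open>auto intro!: AE_I2 simp: abs_le_iff add_nonneg_nonneg min_def\<close>)
    qed (use int_g int_g' quotient t in auto)
    finally show ?thesis using t(1)[of k] by (simp add: pos_divide_le_eq mult.commute)
  qed
  thus ?thesis by (intro LIMSEQ_le[OF lim_G lim_Q]) auto
qed

section \<open>The proximal map of the logarithmic barrier\<close>

locale operator_norm_barrier =
  fixes A :: "'m::finite \<Rightarrow> real^'n^'n" and R :: real
  assumes sym: "transpose (A i) = A i" and R_pos: "0 < R"
begin

definition S :: "real^'m \<Rightarrow> real^'n^'n" where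
  "S x = (\<Sum>i\<in>UNIV. (x $ i) *\<^sub>R A i)"

text \<open>The strict inequality gives an open set on which \<open>R *\<^sub>R mat 1 - S x\<close>
  and \<open>R *\<^sub>R mat 1 + S x\<close> are both positive definite.\<close>

definition D :: "(real^'m) set" where
  "D = {x. onorm ((*v) (S x)) < R}"

text \<open>Since \<open>S\<close> is linear, the inverse of \<open>R *\<^sub>R mat 1 + S x\<close>
  is \<open>U (- x)\<close>.\<close>

definition U :: "real^'m \<Rightarrow> real^'n^'n" where
  "U x = matrix_inv (R *\<^sub>R mat 1 - S x)"

text \<open>The gradient of the barrier \<open>- log det (R - S x) - log det (R + S x)\<close>.\<close>

definition grad :: "real^'m \<Rightarrow> real^'m" where
  "grad x = (\<chi> i. trace (A i ** (U x - U (- x))))"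

text \<open>The equation \<open>T x = y\<close> is the stationarity condition for half the squared
  distance to \<open>y\<close> plus the barrier divided by \<open>R\<^sup>2\<close>, so
  \<open>T\<close> inverts the proximal map.\<close>

definition T :: "real^'m \<Rightarrow> real^'m" where
  "T x = x + (1 / R\<^sup>2) *\<^sub>R grad x"

text \<open>Because of the resolvent identity, differences of \<open>grad\<close> (not only its derivatives) are given by
  this bilinear form; hence no differentiability of the proximal map is ever needed.\<close>

definition hess :: "real^'m \<Rightarrow> real^'m \<Rightarrow> real^'n^'n \<Rightarrow> real^'n^'n \<Rightarrow> real" where
  "hess x x' X Y = trace (X ** U x' ** Y ** U x) + trace (X ** U (- x') ** Y ** U (- x))"

text \<open>On \<open>D\<close> this dominates the square root of the diagonal Hessian entry
  \<open>hess x x (A i) (A i)\<close>; being linear in the resolvents, it can be summed over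
  \<open>i\<close>.\<close>

definition weight :: "'m \<Rightarrow> real^'m \<Rightarrow> real" where
  "weight i x = trace (U x ** matrix_abs (A i)) + trace (U (- x) ** matrix_abs (A i))"

section \<open>The domain of the barrier and the resolvents\<close>

lemma linear_S: "linear S"
  by (rule linearI) (simp_all add: S_def scaleR_left_distrib sum.distrib scaleR_sum_right)

lemmas S_diff = linear_diff[OF linear_S] and S_minus = linear_neg[OF linear_S]

lemma continuous_on_S [continuous_intros]: "continuous_on X f \<Longrightarrow> continuous_on X (\<lambda>x. S (f x))"
  unfolding S_def by (intro continuous_intros)

lemma transpose_S: "transpose (S x) = S x"
  by (simp add: S_def transpose_sum transpose_scaleR sym)

lemma onorm_S_minus: "onorm ((*v) (S (- x))) = onorm ((*v) (S x))"
proof -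
  have "(*v) (S (- x)) = (\<lambda>v. - (S x *v v))"
    by (simp add: fun_eq_iff S_minus vec_eq_iff matrix_vector_mult_def sum_negf)
  thus ?thesis using onorm_neg[of "(*v) (S x)"] by simp
qed

lemma minus_D: "x \<in> D \<Longrightarrow> - x \<in> D"
  by (simp add: D_def onorm_S_minus)

lemma zero_D: "0 \<in> D"
proof -
  have "S 0 = 0" by (rule linear_0[OF linear_S])
  hence "(*v) (S 0) = (\<lambda>v. 0)" by (simp add: fun_eq_iff)
  thus ?thesis using R_pos by (simp add: D_def onorm_zero)
qed

lemma continuous_on_onorm_S: "continuous_on UNIV (\<lambda>x. onorm ((*v) (S x)))"
  by (rule continuous_on_compose2[OF continuous_on_onorm_matrix]) (auto intro!: continuous_intros)

lemma open_D: "open D"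
  unfolding D_def by (intro open_Collect_less continuous_on_onorm_S continuous_on_const)

lemma resolvent_mult: "(R *\<^sub>R mat 1 - S x) *v v = R *\<^sub>R v - S x *v v"
  by (simp add: matrix_vector_mult_diff_rdistrib scaleR_matrix_vector_assoc[symmetric])

lemma resolvent_psd:
  assumes "x \<in> D"
  shows "psd_matrix (R *\<^sub>R mat 1 - S x)"
  unfolding psd_matrix_def
proof (intro conjI allI)
  fix v :: "real^'n"
  have "v \<bullet> (S x *v v) \<le> onorm ((*v) (S x)) * (v \<bullet> v)"
    using abs_inner_le_onorm[of v "S x"] by simp
  also have "\<dots> \<le> R * (v \<bullet> v)" using assms by (intro mult_right_mono) (auto simp: D_def)
  finally show "0 \<le> v \<bullet> ((R *\<^sub>R mat 1 - S x) *v v)" by (simp add: resolvent_mult inner_diff_right)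
qed (simp add: transpose_diff transpose_scaleR transpose_mat transpose_S)

text \<open>A nonzero kernel vector would be stretched by \<open>S x\<close> by the factor
  \<open>R\<close>, which exceeds the operator norm.\<close>

lemma resolvent_invertible:
  assumes "x \<in> D"
  shows "invertible (R *\<^sub>R mat 1 - S x)"
proof -
  have "v = 0" if "(R *\<^sub>R mat 1 - S x) *v v = 0" for v
  proof (rule ccontr)
    assume "v \<noteq> 0"
    have "R *\<^sub>R v = S x *v v" using that by (simp add: resolvent_mult)
    hence "R * norm v = norm (S x *v v)" using R_pos by (metis abs_of_pos norm_scaleR)
    also have "\<dots> \<le> onorm ((*v) (S x)) * norm v" by (intro onorm matrix_vector_mul_bounded_linear)
    also have "\<dots> < R * norm v" using assms \<open>v \<noteq> 0\<close> by (simp add: D_def)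
    finally show False by simp
  qed
  thus ?thesis by (simp add: invertible_left_inverse matrix_left_invertible_ker)
qed

lemma U_psd: "x \<in> D \<Longrightarrow> psd_matrix (U x)"
  unfolding U_def by (intro psd_matrix_inv resolvent_psd resolvent_invertible)

lemma U_diff:
  assumes "x \<in> D" "x' \<in> D"
  shows "U x' - U x = U x' ** S (x' - x) ** U x"
  using matrix_inv_diff[OF resolvent_invertible[OF assms(1)] resolvent_invertible[OF assms(2)]]
  by (simp add: U_def S_diff)

lemma S_mult_U:
  assumes "x \<in> D"
  shows "S x ** U x = R *\<^sub>R U x - mat 1"
proof -
  have "(R *\<^sub>R mat 1 - S x) ** U x = mat 1"
    unfolding U_def by (rule invertible_matrix_inv[OF resolvent_invertible[OF assms]])
  thus ?thesis by (simp add: matrix_mult.diff_left matrix_mult.scaleR_left algebra_simps)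
qed

lemma continuous_on_U: "continuous_on D U" "continuous_on D (\<lambda>x. U (- x))"
  unfolding U_def
  by (intro continuous_on_matrix_inv continuous_intros resolvent_invertible minus_D; assumption)+

section \<open>Increments of the gradient as a positive semidefinite form\<close>

lemma inner_grad: "z \<bullet> grad x = trace (S z ** (U x - U (- x)))"
  by (simp add: grad_def S_def inner_vec_def matrix_mult.sum_left trace_sum
      matrix_mult.scaleR_left trace_scaleR)

text \<open>Apply the resolvent identity at both points and at their negatives. The sign of
  \<open>S (- (x' - x))\<close> cancels the one in front of \<open>U (- x)\<close>, so both traces
  enter with a plus.\<close>

lemma inner_grad_diff:
  assumes "x \<in> D" "x' \<in> D"
  shows "z \<bullet> (grad x' - grad x) = hess x x' (S z) (S (x' - x))"
proof -
  have "U (- x') - U (- x) = - (U (- x') ** S (x' - x) ** U (- x))"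
    using U_diff[OF minus_D[OF assms(1)] minus_D[OF assms(2)]] S_minus[of "x' - x"]
    by (simp add: matrix_mult.minus_left matrix_mult.minus_right)
  moreover have "(U x' - U (- x')) - (U x - U (- x)) = (U x' - U x) - (U (- x') - U (- x))" by simp
  ultimately have eq: "(U x' - U (- x')) - (U x - U (- x)) =
      U x' ** S (x' - x) ** U x + U (- x') ** S (x' - x) ** U (- x)" by (simp add: U_diff[OF assms])
  have "z \<bullet> (grad x' - grad x) = trace (S z ** ((U x' - U (- x')) - (U x - U (- x))))"
    by (simp add: inner_diff_right inner_grad matrix_mult.diff_right trace_sub)
  thus ?thesis unfolding eq by (simp add: hess_def matrix_mult.add_right trace_add matrix_mul_assoc)
qed

lemma hess_nonneg:
  assumes "x \<in> D" "x' \<in> D" "transpose X = X"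
  shows "0 \<le> hess x x' X X"
  unfolding hess_def
  by (intro add_nonneg_nonneg trace_psd_mult_nonneg psd_matrix_congruence U_psd minus_D assms)

text \<open>Transposition followed by cyclicity of the trace exchanges \<open>X\<close> and
  \<open>Y\<close> but keeps the two resolvents in place, even for different \<open>x\<close> and
  \<open>x'\<close>.\<close>

lemma hess_commute:
  assumes "x \<in> D" "x' \<in> D" "transpose X = X" "transpose Y = Y"
  shows "hess x x' X Y = hess x x' Y X"
proof -
  have swap: "trace (X ** P ** Y ** Q) = trace (Y ** P ** X ** Q)"
    if "psd_matrix P" "psd_matrix Q" for P Q :: "real^'n^'n"
  proof -
    have "trace (X ** P ** Y ** Q) = trace (transpose (X ** P ** Y ** Q))" by (simp add: trace_transpose)
    also have "\<dots> = trace (Q ** (Y ** P ** X))"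
      using that assms by (simp add: matrix_transpose_mul psd_matrix_def matrix_mul_assoc)
    also have "\<dots> = trace (Y ** P ** X ** Q)" by (rule trace_mul_sym)
    finally show ?thesis .
  qed
  show ?thesis
    unfolding hess_def by (intro arg_cong2[of _ _ _ _ "(+)"] swap U_psd minus_D assms)
qed

lemma hess_cauchy_schwarz:
  assumes "x \<in> D" "x' \<in> D" "transpose X = X" "transpose Y = Y"
  shows "(hess x x' X Y)\<^sup>2 \<le> hess x x' X X * hess x x' Y Y"
proof (rule nonneg_quadratic_discriminant)
  fix s :: real
  have "0 \<le> hess x x' (X + s *\<^sub>R Y) (X + s *\<^sub>R Y)"
    using assms by (intro hess_nonneg) (simp_all add: transpose_add transpose_scaleR)
  also have "\<dots> = hess x x' X X + s * hess x x' X Y + s * hess x x' Y X + s\<^sup>2 * hess x x' Y Y"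
    by (simp add: hess_def matrix_mult.add_left matrix_mult.add_right matrix_mult.scaleR_left
        matrix_mult.scaleR_right trace_add trace_scaleR power2_eq_square algebra_simps)
  also have "hess x x' Y X = hess x x' X Y" by (rule hess_commute) (use assms in auto)
  finally show "0 \<le> hess x x' X X + 2 * hess x x' X Y * s + hess x x' Y Y * s\<^sup>2"
    by (simp add: algebra_simps)
qed (use hess_nonneg assms in auto)

text \<open>Each of the two traces is bounded by a square through \<open>trace_sandwich_le\<close>,
  and a sum of squares of nonnegative numbers is at most the square of their sum.\<close>

lemma hess_le_weight:
  assumes "x \<in> D" "x' \<in> D"
  shows "hess x x' (A i) (A i) \<le> ((weight i x + weight i x') / 2)\<^sup>2"
proof -
  define a where "a = (trace (U x' ** matrix_abs (A i)) + trace (U x ** matrix_abs (A i))) / 2"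
  define b where "b = (trace (U (- x') ** matrix_abs (A i)) + trace (U (- x) ** matrix_abs (A i))) / 2"
  have "0 \<le> a" "0 \<le> b"
    unfolding a_def b_def using assms
    by (auto intro!: divide_nonneg_nonneg add_nonneg_nonneg trace_psd_mult_nonneg U_psd minus_D
        psd_matrix_abs sym)
  hence "a\<^sup>2 + b\<^sup>2 \<le> (a + b)\<^sup>2" by (simp add: power2_sum)
  moreover have "hess x x' (A i) (A i) \<le> a\<^sup>2 + b\<^sup>2"
    unfolding hess_def a_def b_def
    by (intro add_mono trace_sandwich_le sym U_psd minus_D assms)
  moreover have "a + b = (weight i x + weight i x') / 2"
    by (simp add: a_def b_def weight_def field_simps)
  ultimately show ?thesis by simp
qed

lemma weight_nonneg: "x \<in> D \<Longrightarrow> 0 \<le> weight i x"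
  unfolding weight_def
  by (intro add_nonneg_nonneg trace_psd_mult_nonneg U_psd minus_D psd_matrix_abs sym; assumption)

text \<open>Here the bound on the sum of the absolute values enters: its slack is paired with the
  positive semidefinite resolvents.\<close>

lemma sum_weight_le:
  assumes le: "(\<Sum>i\<in>UNIV. matrix_abs (A i)) \<preceq>\<^sub>L mat 1" and x: "x \<in> D"
  shows "(\<Sum>i\<in>UNIV. weight i x) \<le> trace (U x) + trace (U (- x))"
proof -
  have "0 \<le> trace (P ** (mat 1 - (\<Sum>i\<in>UNIV. matrix_abs (A i))))" if "psd_matrix P" for P
    using that le by (intro trace_psd_mult_nonneg) (simp_all add: loewner_le_def)
  hence "(\<Sum>i\<in>UNIV. trace (P ** matrix_abs (A i))) \<le> trace P" if "psd_matrix P" for P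
    using that by (simp add: matrix_mult.diff_right trace_sub matrix_mult.sum_right trace_sum)
  from add_mono[OF this[OF U_psd[OF x]] this[OF U_psd[OF minus_D[OF x]]]]
  show ?thesis by (simp add: weight_def sum.distrib)
qed

lemma continuous_on_weight: "continuous_on D (weight i)"
  unfolding weight_def by (intro continuous_intros matrix_mult.continuous_on continuous_on_U)

section \<open>Metric properties of the map \<open>T\<close>\<close>

lemma continuous_on_T: "continuous_on D T"
  unfolding T_def grad_def by (intro continuous_intros matrix_mult.continuous_on continuous_on_U)

text \<open>Take traces in \<open>S_mult_U\<close> at \<open>x\<close> and at \<open>- x\<close>;
  the two identity matrices contribute with the same sign.\<close>

lemma inner_self_grad:
  assumes "x \<in> D"
  shows "x \<bullet> grad x = R * (trace (U x) + trace (U (- x))) - 2 * real CARD('n)"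
proof -
  have "S x ** U (- x) = mat 1 - R *\<^sub>R U (- x)"
    using S_mult_U[OF minus_D[OF assms]] by (simp add: S_minus matrix_mult.minus_left algebra_simps)
  hence "trace (S x ** U (- x)) = real CARD('n) - R * trace (U (- x))"
    by (simp add: trace_sub trace_scaleR trace_I)
  moreover have "trace (S x ** U x) = R * trace (U x) - real CARD('n)"
    by (simp add: S_mult_U[OF assms] trace_sub trace_scaleR trace_I)
  ultimately show ?thesis by (simp add: inner_grad matrix_mult.diff_right trace_sub distrib_left)
qed

lemma T_diff_inner:
  assumes "x \<in> D" "x' \<in> D"
  shows "(x' - x) \<bullet> ((T x' - x') - (T x - x)) = hess x x' (S (x' - x)) (S (x' - x)) / R\<^sup>2"
proof -
  have "(T x' - x') - (T x - x) = (1 / R\<^sup>2) *\<^sub>R (grad x' - grad x)" by (simp add: T_def scaleR_diff_right)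
  thus ?thesis by (simp only: inner_scaleR_right inner_grad_diff[OF assms]) simp
qed

text \<open>Monotonicity of the gradient makes the increments of \<open>x\<close> and of
  \<open>T x - x\<close> have nonnegative inner product. This is firm nonexpansiveness of the
  inverse of \<open>T\<close>.\<close>

lemma T_pythagoras:
  assumes "x \<in> D" "x' \<in> D"
  shows "(norm (x' - x))\<^sup>2 + (norm ((T x' - x') - (T x - x)))\<^sup>2 \<le> (norm (T x' - T x))\<^sup>2"
proof -
  define u where "u = x' - x"
  define w where "w = (T x' - x') - (T x - x)"
  have "0 \<le> u \<bullet> w"
    unfolding u_def w_def T_diff_inner[OF assms] by (intro divide_nonneg_nonneg hess_nonneg assms transpose_S) simp
  moreover have "T x' - T x = u + w" by (simp add: u_def w_def)
  ultimately show ?thesis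
    by (simp add: u_def[symmetric] w_def[symmetric] power2_norm_eq_inner inner_add_left
        inner_add_right inner_commute)
qed

lemma T_expansive:
  assumes "x \<in> D" "x' \<in> D"
  shows "dist x x' \<le> dist (T x) (T x')"
proof -
  have "(norm (x' - x))\<^sup>2 \<le> (norm (T x' - T x))\<^sup>2"
    using T_pythagoras[OF assms] zero_le_power2[of "norm ((T x' - x') - (T x - x))"] by linarith
  hence "norm (x' - x) \<le> norm (T x' - T x)" by (rule power2_le_imp_le) simp
  thus ?thesis by (simp add: dist_norm norm_minus_commute)
qed

lemma T_zero: "T 0 = 0"
  by (simp add: T_def grad_def vec_eq_iff trace_0[unfolded mat_0])

lemma T_norm:
  assumes "x \<in> D"
  shows "norm x \<le> norm (T x)" "norm (T x - x) \<le> norm (T x)"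
proof -
  have "(norm x)\<^sup>2 + (norm (T x - x))\<^sup>2 \<le> (norm (T x))\<^sup>2"
    using T_pythagoras[OF zero_D assms] by (simp add: T_zero)
  hence "(norm x)\<^sup>2 \<le> (norm (T x))\<^sup>2" "(norm (T x - x))\<^sup>2 \<le> (norm (T x))\<^sup>2"
    using zero_le_power2[of "norm x"] zero_le_power2[of "norm (T x - x)"] by linarith+
  thus "norm x \<le> norm (T x)" "norm (T x - x) \<le> norm (T x)" by (auto intro: power2_le_imp_le)
qed

text \<open>The increments \<open>u\<close> of \<open>x\<close> and \<open>w\<close> of
  \<open>T x - x\<close> add up to \<open>t *\<^sub>R axis i 1\<close>. Nonnegativity of
  \<open>u \<bullet> w\<close> puts \<open>d = w $ i\<close> between 0 and \<open>t\<close>, and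
  Cauchy-Schwarz for \<open>hess\<close> gives \<open>d \<le> t * h\<close>. These are
  finite-increment forms of bounding a derivative by 1 and by a Hessian entry.\<close>

lemma T_quotient:
  assumes x: "x \<in> D" "x' \<in> D" and t: "0 < t" and T: "T x' = T x + t *\<^sub>R axis i 1"
  shows "(T x' - x') $ i - (T x - x) $ i \<le> t * min 1 ((weight i x / R + weight i x' / R) / 2)"
proof -
  define u where "u = x' - x"
  define w where "w = (T x' - x') - (T x - x)"
  define d where "d = w $ i"
  define h where "h = hess x x' (A i) (A i) / R\<^sup>2"
  define c where "c = (weight i x / R + weight i x' / R) / 2"
  have c: "0 \<le> c" unfolding c_def using x weight_nonneg R_pos by (intro divide_nonneg_nonneg add_nonneg_nonneg) auto
  have uw: "u \<bullet> w = hess x x' (S u) (S u) / R\<^sup>2" unfolding u_def w_def by (rule T_diff_inner[OF x])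
  have "d\<^sup>2 \<le> (norm w)\<^sup>2"
    using component_le_norm_cart[of w i] by (metis abs_norm_cancel abs_le_square_iff d_def)
  moreover have "u = t *\<^sub>R axis i 1 - w" using T by (simp add: u_def w_def)
  hence "u \<bullet> w = t * d - (norm w)\<^sup>2"
    by (simp add: inner_diff_left power2_norm_eq_inner d_def inner_axis' )
  ultimately have uw_le: "u \<bullet> w \<le> t * d - d\<^sup>2" by simp
  have "0 \<le> u \<bullet> w"
    unfolding uw by (intro divide_nonneg_nonneg hess_nonneg x transpose_S) simp
  with uw_le have td: "d * d \<le> t * d" by (simp add: power2_eq_square)
  have "0 \<le> t * d" using td zero_le_square[of d] by linarith
  hence d0: "0 \<le> d" using t by (simp add: zero_le_mult_iff)
  have dt: "d \<le> t"
  proof (cases "d = 0")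
    case False
    thus ?thesis using td d0 by simp
  qed (use t in simp)
  have "d \<le> t * h"
  proof (cases "d = 0")
    case True
    have "0 \<le> h" unfolding h_def by (intro divide_nonneg_nonneg hess_nonneg x sym) simp
    thus ?thesis using True t by simp
  next
    case False
    have "S (axis i 1) = (\<Sum>j\<in>UNIV. if j = i then A i else 0)"
      unfolding S_def by (rule sum.cong) (auto simp: axis_def)
    hence Si: "S (axis i 1) = A i" by simp
    have "w = (1 / R\<^sup>2) *\<^sub>R (grad x' - grad x)" by (simp add: w_def T_def scaleR_diff_right)
    \<comment> \<open>The component \<open>d\<close> is a mixed value of the form, so Cauchy-Schwarz
      against \<open>S u\<close> brings in \<open>u \<bullet> w \<le> t * d\<close>, and one factor
      \<open>d\<close> cancels.\<close>
    hence "d = hess x x' (A i) (S u) / R\<^sup>2"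
      using inner_grad_diff[OF x, of "axis i 1"] unfolding Si u_def d_def by (simp add: inner_axis')
    hence "d\<^sup>2 = (hess x x' (A i) (S u))\<^sup>2 / (R\<^sup>2 * R\<^sup>2)"
      by (simp add: power_divide power2_eq_square)
    also have "\<dots> \<le> (hess x x' (A i) (A i) * hess x x' (S u) (S u)) / (R\<^sup>2 * R\<^sup>2)"
      by (intro divide_right_mono hess_cauchy_schwarz x sym transpose_S) simp
    also have "\<dots> = h * (u \<bullet> w)" by (simp add: h_def uw)
    also have "\<dots> \<le> h * (t * d)"
    proof (rule mult_left_mono)
      show "u \<bullet> w \<le> t * d" using uw_le zero_le_power2[of d] by linarith
    qed (use hess_nonneg[OF x sym] in \<open>simp add: h_def\<close>)
    finally have "d * d \<le> (t * h) * d" by (simp add: power2_eq_square mult_ac)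
    thus ?thesis using d0 False by simp
  qed
  also have "h \<le> c\<^sup>2"
  proof -
    have "h \<le> ((weight i x + weight i x') / 2)\<^sup>2 / R\<^sup>2"
      unfolding h_def by (intro divide_right_mono hess_le_weight x) simp
    also have "\<dots> = c\<^sup>2" by (simp add: c_def power_divide[symmetric] add_divide_distrib[symmetric] mult.commute)
    finally show ?thesis .
  qed
  finally have dc: "d \<le> t * c\<^sup>2" using t by simp
  \<comment> \<open>For \<open>c \<le> 1\<close> the square is traded for \<open>c\<close>, which is
    linear in the traces; otherwise \<open>d \<le> t\<close> suffices.\<close>
  have "d \<le> t * min 1 c"
  proof (cases "c \<le> 1")
    case True
    hence "t * c\<^sup>2 \<le> t * c" using c t by (simp add: power2_eq_square mult_left_le)
    thus ?thesis using dc True by (simp add: min_def)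
  qed (use dt in simp)
  thus ?thesis by (simp add: d_def w_def c_def)
qed

text \<open>Bounded traces keep the eigenvalues of \<open>R *\<^sub>R mat 1 - S z\<close> at least
  \<open>1 / \<tau>\<close> for \<open>z = x k\<close> and \<open>z = - x k\<close>. The
  corresponding quadratic inequality is closed, so it holds in the limit and leaves a gap below
  \<open>R\<close>.\<close>

lemma mem_D_if_trace_bounded:
  assumes x: "\<And>k. x k \<in> D" and lim: "x \<longlonglongrightarrow> a"
    and tr: "\<And>k. trace (U (x k)) + trace (U (- x k)) \<le> \<tau>"
  shows "a \<in> D"
proof -
  have nonneg: "0 \<le> trace (U z)" if "z \<in> D" for z
    using trace_psd_mult_nonneg[OF U_psd[OF that], of "mat 1"]
    by (simp add: psd_matrix_def transpose_mat)
  have "0 \<le> \<tau>" using tr[of 0] nonneg[OF x] nonneg[OF minus_D[OF x]] by (meson add_nonneg_nonneg order_trans)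
  have bound: "v \<bullet> v \<le> \<tau> * (v \<bullet> (R *\<^sub>R v - S z *v v))"
    if z: "z \<in> D" "trace (U z) \<le> \<tau>" for z v
    using quadratic_ge_inverse_trace[OF resolvent_psd[OF z(1)] resolvent_invertible[OF z(1)], of \<tau> v] z(2)
    by (simp add: U_def resolvent_mult)
  have cl: "v \<bullet> v \<le> \<tau> * (v \<bullet> (R *\<^sub>R v - S b *v v))"
    if z: "\<And>k. z k \<in> D" "\<And>k. trace (U (z k)) \<le> \<tau>" "z \<longlonglongrightarrow> b" for z b v
  proof (rule LIMSEQ_le_const)
    have "continuous_on UNIV (\<lambda>z. \<tau> * (v \<bullet> (R *\<^sub>R v - S z *v v)))"
      unfolding S_def sum_matrix_mult scaleR_matrix_vector_assoc[symmetric] by (intro continuous_intros)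
    hence "isCont (\<lambda>z. \<tau> * (v \<bullet> (R *\<^sub>R v - S z *v v))) b"
      by (simp add: continuous_on_eq_continuous_at)
    thus "(\<lambda>k. \<tau> * (v \<bullet> (R *\<^sub>R v - S (z k) *v v))) \<longlonglongrightarrow> \<tau> * (v \<bullet> (R *\<^sub>R v - S b *v v))"
      using z(3) by (rule isCont_tendsto_compose)
  qed (use bound z in blast)
  have trk: "trace (U (x k)) \<le> \<tau>" "trace (U (- x k)) \<le> \<tau>" for k
    using tr[of k] nonneg[OF x[of k]] nonneg[OF minus_D[OF x[of k]]] by auto
  have up: "v \<bullet> v \<le> \<tau> * (v \<bullet> (R *\<^sub>R v - S a *v v))" for v
    by (rule cl[OF x trk(1) lim])
  have down: "v \<bullet> v \<le> \<tau> * (v \<bullet> (R *\<^sub>R v + S a *v v))" for v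
  proof -
    have "v \<bullet> v \<le> \<tau> * (v \<bullet> (R *\<^sub>R v - S (- a) *v v))"
      by (rule cl[OF minus_D[OF x] trk(2) tendsto_minus[OF lim]])
    also have "S (- a) *v v = - (S a *v v)"
      by (simp add: S_minus vec_eq_iff matrix_vector_mult_def sum_negf)
    finally show ?thesis by simp
  qed
  \<comment> \<open>At a unit vector the left side is 1, which excludes
    \<open>\<tau> = 0\<close>.\<close>
  have "\<tau> \<noteq> 0" using up[of "axis undefined 1"] by (auto simp: inner_axis_axis)
  hence \<tau>: "0 < \<tau>" using \<open>0 \<le> \<tau>\<close> by simp
  have quad: "\<bar>v \<bullet> (S a *v v)\<bar> \<le> (R - 1 / \<tau>) * (v \<bullet> v)" for v
    using up[of v] down[of v] \<tau>
    by (simp add: inner_diff_right inner_add_right abs_le_iff field_simps)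
  have "0 \<le> R - 1 / \<tau>"
    using order_trans[OF abs_ge_zero quad[of "axis undefined 1"]] by (simp add: inner_axis_axis)
  hence "onorm ((*v) (S a)) \<le> R - 1 / \<tau>"
    by (rule onorm_symmetric_le[OF transpose_S _ quad])
  also have "\<dots> < R" using \<tau> by simp
  finally show ?thesis by (simp add: D_def)
qed

lemma inner_T_diff:
  assumes "x \<in> D"
  shows "x \<bullet> (T x - x) = (trace (U x) + trace (U (- x))) / R - 2 * real CARD('n) / R\<^sup>2"
proof -
  have "x \<bullet> (T x - x) = (R * (trace (U x) + trace (U (- x))) - 2 * real CARD('n)) / R\<^sup>2"
    by (simp add: T_def inner_self_grad[OF assms])
  also have "R * (trace (U x) + trace (U (- x))) / R\<^sup>2 = (trace (U x) + trace (U (- x))) / R"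
    using R_pos by (simp add: power2_eq_square)
  hence "(R * (trace (U x) + trace (U (- x))) - 2 * real CARD('n)) / R\<^sup>2
      = (trace (U x) + trace (U (- x))) / R - 2 * real CARD('n) / R\<^sup>2"
    by (simp only: diff_divide_distrib)
  finally show ?thesis .
qed

text \<open>Expansiveness makes the preimages of a convergent sequence Cauchy, so only a limit
  outside \<open>D\<close> must be excluded. By \<open>inner_T_diff\<close> the norms of the images
  bound the traces, which excludes it.\<close>

lemma closed_range_T: "closed (T ` D)"
  unfolding closed_sequential_limits
proof (intro allI impI, elim conjE)
  fix y b assume y: "\<forall>k. y k \<in> T ` D" and lim: "y \<longlonglongrightarrow> b"
  have "\<exists>x. x \<in> D \<and> T x = y k" for k using y[THEN spec, of k] by auto
  then obtain x where x: "\<And>k. x k \<in> D" "\<And>k. T (x k) = y k" by metis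
  have "Cauchy x"
  proof (rule metric_CauchyI)
    fix e :: real assume "e > 0"
    then obtain M where "\<forall>m\<ge>M. \<forall>n\<ge>M. dist (y m) (y n) < e"
      using LIMSEQ_imp_Cauchy[OF lim] by (meson metric_CauchyD)
    moreover have "dist (x m) (x n) \<le> dist (y m) (y n)" for m n
      using T_expansive[OF x(1) x(1), of m n] by (simp add: x(2))
    ultimately show "\<exists>M. \<forall>m\<ge>M. \<forall>n\<ge>M. dist (x m) (x n) < e" by (meson le_less_trans)
  qed
  then obtain a where a: "x \<longlonglongrightarrow> a" by (auto simp: Cauchy_convergent_iff convergent_def)
  obtain C where C: "\<And>k. norm (y k) \<le> C"
    using convergent_imp_Bseq[OF convergentI[OF lim]] by (auto simp: Bseq_def)
  have "trace (U (x k)) + trace (U (- x k)) \<le> R * (C * C + 2 * real CARD('n) / R\<^sup>2)" for k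
  proof -
    have "x k \<bullet> (y k - x k) \<le> norm (x k) * norm (y k - x k)" by (rule norm_cauchy_schwarz)
    also have "\<dots> \<le> C * C"
      using T_norm[OF x(1)[of k]] C[of k] order_trans[OF norm_ge_zero C] unfolding x(2)
      by (intro mult_mono) auto
    finally have "(trace (U (x k)) + trace (U (- x k))) / R \<le> C * C + 2 * real CARD('n) / R\<^sup>2"
      using inner_T_diff[OF x(1)[of k]] by (simp add: x(2))
    thus ?thesis using R_pos by (simp add: pos_divide_le_eq mult.commute)
  qed
  hence aD: "a \<in> D" by (rule mem_D_if_trace_bounded[OF x(1) a])
  have "isCont T a" using continuous_on_T open_D aD by (simp add: continuous_on_eq_continuous_at)
  hence "(\<lambda>k. T (x k)) \<longlonglongrightarrow> T a" using a by (rule isCont_tendsto_compose)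
  hence "T a = b" using lim LIMSEQ_unique by (simp add: x(2))
  thus "b \<in> T ` D" using aD by blast
qed

text \<open>The image of \<open>T\<close> is open by invariance of domain and closed because the traces in \<open>U\<close> blow up at
  the boundary of \<open>D\<close>.\<close>

lemma T_bij: "bij_betw T D UNIV"
proof -
  have inj: "inj_on T D"
    by (rule inj_onI) (use T_expansive in fastforce)
  have "open (T ` D)" by (rule invariance_of_domain[OF continuous_on_T open_D inj])
  hence "T ` D = UNIV" using closed_range_T clopen[of "T ` D"] zero_D by blast
  with inj show ?thesis by (simp add: bij_betw_def)
qed

definition prox :: "real^'m \<Rightarrow> real^'m" where
  "prox = inv_into D T"

lemma prox_mem: "prox y \<in> D" and T_prox: "T (prox y) = y"
  using T_bij unfolding prox_def bij_betw_def by (simp_all add: inv_into_into f_inv_into_f)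

lemma continuous_on_prox: "continuous_on UNIV prox"
proof -
  have "1-lipschitz_on UNIV prox"
    using T_expansive[OF prox_mem prox_mem] by (intro lipschitz_onI) (auto simp: T_prox)
  thus ?thesis by (rule lipschitz_on_continuous_on)
qed

lemma expectation_prox_dist:
  assumes le: "(\<Sum>i\<in>UNIV. matrix_abs (A i)) \<preceq>\<^sub>L mat 1"
  shows "integrable std_gaussian (\<lambda>y. (norm (y - prox y))\<^sup>2)"
    and "(\<integral>y. (norm (y - prox y))\<^sup>2 \<partial>std_gaussian) \<le> 2 * real CARD('n) / R\<^sup>2"
proof -
  interpret prob_space "std_gaussian :: (real^'m) measure" by (rule prob_space_std_gaussian)
  let ?g = "\<lambda>y. y - prox y"
  let ?q = "\<lambda>i y. weight i (prox y) / R"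
  have cont_g: "continuous_on UNIV ?g" by (intro continuous_intros continuous_on_prox)
  have cont_q: "continuous_on UNIV (?q i)" for i
  proof -
    have "continuous_on UNIV (\<lambda>y. weight i (prox y))"
      by (rule continuous_on_compose2[OF continuous_on_weight continuous_on_prox]) (auto simp: prox_mem)
    thus ?thesis by (intro continuous_intros) (use R_pos in auto)
  qed
  have [measurable]: "prox \<in> borel_measurable borel"
    by (rule borel_measurable_continuous_onI[OF continuous_on_prox])
  have [measurable]: "?q i \<in> borel_measurable borel" for i
    by (rule borel_measurable_continuous_onI[OF cont_q])
  have prox_le: "norm (prox y) \<le> norm y" and g_le: "norm (?g y) \<le> norm y" for y
    using T_norm[OF prox_mem[of y]] by (simp_all add: T_prox)
  have q_nonneg: "0 \<le> ?q i y" for i y using weight_nonneg[OF prox_mem] R_pos by simp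
  \<comment> \<open>Both \<open>prox y\<close> and \<open>?g y\<close> are bounded in norm by
    \<open>norm y\<close>, so the products below need only second moments.\<close>
  have int_bound: "integrable std_gaussian f"
    if "f \<in> borel_measurable borel" "\<And>y. \<bar>f y\<bar> \<le> norm y * norm y" for f :: "real^'m \<Rightarrow> real"
    by (rule Bochner_Integration.integrable_bound[OF integrable_std_gaussian_norm_power[of 2]])
      (use that in \<open>auto simp: power2_eq_square\<close>)
  have int_g: "integrable std_gaussian (\<lambda>y. ?g y $ i * y $ i)" for i
  proof (rule int_bound)
    fix y
    show "\<bar>?g y $ i * y $ i\<bar> \<le> norm y * norm y"
      unfolding abs_mult
      by (intro mult_mono component_le_norm_cart order_trans[OF component_le_norm_cart g_le]) auto
  qed (intro borel_measurable_continuous_onI continuous_intros cont_g)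
  have int_x: "integrable std_gaussian (\<lambda>y. prox y \<bullet> ?g y)"
  proof (rule int_bound)
    fix y
    show "\<bar>prox y \<bullet> ?g y\<bar> \<le> norm y * norm y"
      by (rule order_trans[OF Cauchy_Schwarz_ineq2]) (intro mult_mono prox_le g_le norm_ge_zero)
  qed (intro borel_measurable_continuous_onI continuous_intros cont_g continuous_on_prox)
  \<comment> \<open>The cap at 1 gives integrability without any bound on the weights.\<close>
  have int_min: "integrable std_gaussian (\<lambda>y. min 1 (?q i y))" for i
    by (rule integrable_const_bound[where B = 1])
      (use q_nonneg in \<open>auto intro!: AE_I2 simp: abs_le_iff min_def intro: order_trans[of _ 0]\<close>)
  show "integrable std_gaussian (\<lambda>y. (norm (?g y))\<^sup>2)"
    by (rule int_bound) (use g_le in \<open>auto simp: power2_eq_square intro!: mult_mono\<close>)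
  have stein: "(\<integral>y. ?g y $ i * y $ i \<partial>std_gaussian) \<le> (\<integral>y. min 1 (?q i y) \<partial>std_gaussian)" for i
  proof (rule std_gaussian_stein_le[OF _ cont_q _ q_nonneg])
    show "continuous_on UNIV (\<lambda>y. ?g y $ i)" by (intro continuous_intros cont_g)
    show "\<bar>?g y $ i\<bar> \<le> norm y" for y by (rule order_trans[OF component_le_norm_cart g_le])
    fix y :: "real^'m" and t :: real assume "0 < t"
    from T_quotient[OF prox_mem prox_mem this, of "y + t *\<^sub>R axis i 1" y i]
    show "?g (y + t *\<^sub>R axis i 1) $ i - ?g y $ i \<le> t * min 1 ((?q i y + ?q i (y + t *\<^sub>R axis i 1)) / 2)"
      by (simp add: T_prox)
  qed
  \<comment> \<open>One factor of the squared norm is split as \<open>y\<close> minus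
    \<open>prox y\<close>; \<open>stein\<close> handles the product with \<open>y\<close>.\<close>
  have "(\<integral>y. (norm (?g y))\<^sup>2 \<partial>std_gaussian)
      = (\<integral>y. (\<Sum>i\<in>UNIV. ?g y $ i * y $ i) - prox y \<bullet> ?g y \<partial>std_gaussian)"
    by (rule Bochner_Integration.integral_cong[OF refl])
      (simp add: inner_vec_def power2_norm_eq_inner sum_subtractf[symmetric] algebra_simps)
  also have "\<dots> = (\<Sum>i\<in>UNIV. \<integral>y. ?g y $ i * y $ i \<partial>std_gaussian) - (\<integral>y. prox y \<bullet> ?g y \<partial>std_gaussian)"
    by (subst Bochner_Integration.integral_diff)
      (use int_g int_x in \<open>auto intro!: Bochner_Integration.integrable_sum Bochner_Integration.integral_sum\<close>)
  also have "\<dots> \<le> (\<Sum>i\<in>UNIV. \<integral>y. min 1 (?q i y) \<partial>std_gaussian) - (\<integral>y. prox y \<bullet> ?g y \<partial>std_gaussian)"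
    by (intro diff_right_mono sum_mono stein)
  also have "(\<Sum>i\<in>UNIV. \<integral>y. min 1 (?q i y) \<partial>std_gaussian) = (\<integral>y. (\<Sum>i\<in>UNIV. min 1 (?q i y)) \<partial>std_gaussian)"
    by (rule Bochner_Integration.integral_sum[symmetric]) (rule int_min)
  \<comment> \<open>The cap is dropped only inside a pointwise inequality: the weights sum to at
    most the trace term in \<open>inner_T_diff\<close>, so after the subtraction only the constant
    remains.\<close>
  also have "\<dots> \<le> (\<integral>y. prox y \<bullet> ?g y + 2 * real CARD('n) / R\<^sup>2 \<partial>std_gaussian)"
  proof (rule integral_mono)
    fix y
    have "(\<Sum>i\<in>UNIV. min 1 (?q i y)) \<le> (\<Sum>i\<in>UNIV. ?q i y)" by (intro sum_mono) simp
    also have "\<dots> \<le> (trace (U (prox y)) + trace (U (- prox y))) / R"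
      unfolding sum_divide_distrib[symmetric]
      by (intro divide_right_mono sum_weight_le[OF le prox_mem]) (use R_pos in simp)
    also have "\<dots> = prox y \<bullet> ?g y + 2 * real CARD('n) / R\<^sup>2"
      using inner_T_diff[OF prox_mem[of y]] by (simp add: T_prox)
    finally show "(\<Sum>i\<in>UNIV. min 1 (?q i y)) \<le> prox y \<bullet> ?g y + 2 * real CARD('n) / R\<^sup>2" .
  qed (intro Bochner_Integration.integrable_sum int_min Bochner_Integration.integrable_add int_x integrable_const)+
  also have "\<dots> = (\<integral>y. prox y \<bullet> ?g y \<partial>std_gaussian) + 2 * real CARD('n) / R\<^sup>2"
    by (subst Bochner_Integration.integral_add[OF int_x]) (simp_all add: prob_space[simplified])
  finally show "(\<integral>y. (norm (?g y))\<^sup>2 \<partial>std_gaussian) \<le> 2 * real CARD('n) / R\<^sup>2" by simp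
qed

end

section \<open>From the mean squared distance to Gaussian measure\<close>

theorem theorem1:
  fixes A :: "'m::finite \<Rightarrow> real^'n^'n"
    and \<epsilon> \<alpha> :: real
    and K :: "(real^'m) set"
  assumes "\<And>i. transpose (A i) = A i"
    and "(\<Sum>i\<in>UNIV. matrix_abs (A i)) \<preceq>\<^sub>L mat 1"
    and "0 < \<epsilon>" and "\<epsilon> < 1"
    and "real CARD('m) = real CARD('n) / \<epsilon>\<^sup>2"
    and "CARD('m) \<ge> 100"
    and "K = {x. op_norm (\<Sum>i\<in>UNIV. (x $ i) *\<^sub>R A i) \<le> \<epsilon>}"
    and "0 < \<alpha>" and "\<alpha> < 1"
  shows "measure (std_gaussian :: (real^'m) measure)
           ((\<lambda>x. (50 / \<alpha>) *\<^sub>R x) ` K + (\<lambda>x. (\<alpha> * sqrt (real CARD('m))) *\<^sub>R x) ` cball 0 1) \<ge> 1 / 2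
         \<and> measure (std_gaussian :: (real^'m) measure)
           {y. infdist y ((\<lambda>x. (50 / \<alpha>) *\<^sub>R x) ` K) \<le> \<alpha> * sqrt (real CARD('m))} \<ge> 1 / 2"
proof -
  \<comment> \<open>Scaling \<open>K\<close> by \<open>50 / \<alpha>\<close> scales its norm bound
    \<open>\<epsilon>\<close> to \<open>R\<close>.\<close>
  define R where "R = 50 * \<epsilon> / \<alpha>"
  define r where "r = \<alpha> * sqrt (real CARD('m))"
  let ?K = "(\<lambda>x. (50 / \<alpha>) *\<^sub>R x) ` K" and ?B = "(\<lambda>x :: real^'m. r *\<^sub>R x) ` cball 0 1"
  have r: "0 < r" using assms(6,8) by (simp add: r_def)
  interpret operator_norm_barrier A R
    by unfold_locales (use assms in \<open>simp_all add: R_def\<close>)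
  interpret prob_space "std_gaussian :: (real^'m) measure" by (rule prob_space_std_gaussian)
  have K: "K = {x. onorm ((*v) (S x)) \<le> \<epsilon>}"
    using assms(7) by (simp add: S_def op_norm_eq_onorm)
  have D_K: "D \<subseteq> ?K"
  proof
    fix x assume x: "x \<in> D"
    have "S ((\<alpha> / 50) *\<^sub>R x) = (\<alpha> / 50) *\<^sub>R S x" by (rule linear_scale[OF linear_S])
    hence "(*v) (S ((\<alpha> / 50) *\<^sub>R x)) = (\<lambda>v. (\<alpha> / 50) *\<^sub>R (S x *v v))"
      by (simp add: fun_eq_iff scaleR_matrix_vector_assoc)
    hence "onorm ((*v) (S ((\<alpha> / 50) *\<^sub>R x))) = \<alpha> / 50 * onorm ((*v) (S x))"
      using onorm_scaleR[OF matrix_vector_mul_bounded_linear, of "\<alpha> / 50" "S x"] assms(8) by simp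
    also have "\<dots> \<le> \<alpha> / 50 * R" using x assms(8) by (intro mult_left_mono) (auto simp: D_def)
    also have "\<dots> = \<epsilon>" using assms(8) by (simp add: R_def)
    finally have "(\<alpha> / 50) *\<^sub>R x \<in> K" by (simp add: K)
    moreover have "x = (50 / \<alpha>) *\<^sub>R ((\<alpha> / 50) *\<^sub>R x)" using assms(8) by simp
    ultimately show "x \<in> ?K" by blast
  qed
  have "closed K"
    unfolding K by (intro closed_Collect_le continuous_on_onorm_S continuous_on_const)
  hence clK: "closed ?K" using closed_scaling by blast
  \<comment> \<open>Compactness of \<open>?B\<close> makes the Minkowski sum closed, hence
    measurable.\<close>
  have "?K + ?B = (\<Union>x\<in>?K. \<Union>y\<in>?B. {x + y})" unfolding set_plus_def by blast
  hence "closed (?K + ?B)"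
    using closed_compact_sums[OF clK compact_scaling[OF compact_cball, of r 0 1]] by (simp only:)
  hence sum_sets: "?K + ?B \<in> sets std_gaussian" by simp
  \<comment> \<open>As \<open>?K\<close> is closed and contains 0, \<open>infdist\<close> is an
    attained minimal distance here and not the default value for the empty set.\<close>
  have "closed {y. infdist y ?K \<le> r}"
    by (intro closed_Collect_le continuous_intros)
  hence dist_sets: "{y. infdist y ?K \<le> r} \<in> sets std_gaussian" by simp
  \<comment> \<open>The strict inequality makes the complement of \<open>G\<close> exactly the event
    in Markov's inequality.\<close>
  define G where "G = {y. (norm (y - prox y))\<^sup>2 < r\<^sup>2}"
  have "open G"
    unfolding G_def by (intro open_Collect_less continuous_intros continuous_on_prox)
  hence G_sets: "G \<in> sets std_gaussian" by simp
  have "measure std_gaussian {y \<in> space std_gaussian. r\<^sup>2 \<le> (norm (y - prox y))\<^sup>2}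
      \<le> (\<integral>y. (norm (y - prox y))\<^sup>2 \<partial>std_gaussian) / r\<^sup>2"
    by (rule integral_Markov_inequality_measure[where A = "{}"])
      (use expectation_prox_dist(1)[OF assms(2)] r in auto)
  also have "\<dots> \<le> (2 * real CARD('n) / R\<^sup>2) / r\<^sup>2"
    by (intro divide_right_mono expectation_prox_dist(2) assms) simp
  \<comment> \<open>The factor \<open>\<alpha>\<close> cancels in \<open>R * r\<close>, and
    \<open>R\<^sup>2 * r\<^sup>2\<close> equals 2500 times \<open>CARD('n)\<close> because
    \<open>CARD('m)\<close> times \<open>\<epsilon>\<^sup>2\<close> is
    \<open>CARD('n)\<close>.\<close>
  also have "\<dots> = 2 / 2500"
    using assms(3,5,8) by (simp add: R_def r_def power_mult_distrib power_divide)
  finally have "measure std_gaussian (UNIV - G) \<le> 1 / 2"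
    by (simp add: G_def set_diff_eq not_less)
  hence G: "1 / 2 \<le> measure std_gaussian G"
    using prob_compl[OF G_sets] by simp
  have near: "norm (y - prox y) \<le> r" if "y \<in> G" for y
  proof (rule power2_le_imp_le)
    show "(norm (y - prox y))\<^sup>2 \<le> r\<^sup>2" using that unfolding G_def mem_Collect_eq by (rule less_imp_le)
  qed (use r in simp)
  have B: "?B = cball 0 r"
    using cball_scale[of r "0 :: real^'m" 1] r by simp
  have "y \<in> ?K + ?B" if "y \<in> G" for y
  proof -
    have "y - prox y \<in> ?B" unfolding B using near[OF that] by simp
    with subsetD[OF D_K prox_mem] have "prox y + (y - prox y) \<in> ?K + ?B" by (rule set_plus_intro)
    thus ?thesis by simp
  qed
  hence "G \<subseteq> ?K + ?B" by (rule subsetI)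
  moreover have "G \<subseteq> {y. infdist y ?K \<le> r}"
  proof
    fix y assume "y \<in> G"
    have "infdist y ?K \<le> dist y (prox y)" by (rule infdist_le[OF subsetD[OF D_K prox_mem]])
    thus "y \<in> {y. infdist y ?K \<le> r}" using near[OF \<open>y \<in> G\<close>] by (simp add: dist_norm)
  qed
  ultimately have "1 / 2 \<le> measure std_gaussian (?K + ?B)" "1 / 2 \<le> measure std_gaussian {y. infdist y ?K \<le> r}"
    using G finite_measure_mono[OF _ sum_sets, of G] finite_measure_mono[OF _ dist_sets, of G] by simp_all
  thus ?thesis unfolding r_def by (rule conjI)
qed

end
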